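(* Let $\Omega_{s,h},\Omega_{m,h}\subset\mathbb R^2$ be triangulated domains with (possibly spatially noncoincident) discrete interfaces $\Gamma^c_{s,h},\Gamma^c_{m,h}$, maps $\phi_{sm},\phi_{ms}$ between them, and discrete spaces and operators $\mathbf V^h_i,\mathbf V^h_{i,0},\mathbf W^h_s,E_{sm},\overline\sigma_s$ as defined in the context, and write $\hat{\mathbf x}_m=\phi_{sm}(\mathbf x_s)$. Let $\omega\in(0,1]$, let $\mathbf g_0$ be an initial guess on $\Gamma^c_{s,h}$, and let $(\mathbf u_{s,k}^h,\mathbf u_{m,k}^h)\in\mathbf V^h_s\times\mathbf V^h_m$ and $\mathbf g_k$, $k=0,1,2,\dots$, be sequences satisfying the iteration $$ \begin{aligned} a^h_s(\mathbf u_{s,k}^h,\mathbf v_s^h)&=\langle\mathbf f_s,\mathbf v_s^h\rangle_{\Omega_{s,h}}&&\forall\,\mathbf v_s^h\in\mathbf V^h_{s,0},\\ \langle\mathbf u_{s,k}^h,\mathbf w_s^h\rangle_{\Gamma^c_{s,h}}&=\langle\mathbf g_k,\mathbf w_s^h\rangle_{\Gamma^c_{s,h}}&&\forall\,\mathbf w_s^h\in\mathbf W^h_s,\\ a^h_m(\mathbf u_{m,k}^h,\mathbf v_m^h)-\langle\overline\sigma_s(\mathbf u_{s,k}^h)\mathbf n_m,\mathbf v_m^h\rangle_{\Gamma^c_{m,h}}&=\langle\mathbf f_m,\mathbf v_m^h\rangle_{\Omega_{m,h}}&&\forall\,\mathbf v_m^h\in\mathbf V^h_m, \end{aligned} $$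 $$\mathbf g_{k+1}(\mathbf x_s)=\omega\bigl(\mathbf u_{m,k}^h(\hat{\mathbf x}_m)-\nabla\mathbf u_{s,k}^h(\mathbf x_s)(\hat{\mathbf x}_m-\mathbf x_s)\bigr)+(1-\omega)\mathbf g_k(\mathbf x_s),\qquad \mathbf x_s\in\Gamma^c_{s,h}.$$ Assume that the iteration is convergent, i.e. that $\mathbf g_k$, $\mathbf u_{s,k}^h$ and $\mathbf u_{m,k}^h$ converge as $k\to\infty$. Then the limit $(\mathbf u_s^h,\mathbf u_m^h)=\lim_{k\to\infty}(\mathbf u_{s,k}^h,\mathbf u_{m,k}^h)\in\mathbf V^h_s\times\mathbf V^h_m$ is a solution of the monolithic coupled problem $$ \begin{aligned} a^h_s(\mathbf u_s^h,\mathbf v_s^h)&=\langle\mathbf f_s,\mathbf v_s^h\rangle_{\Omega_{s,h}}&&\forall\,\mathbf v_s^h\in\mathbf V^h_{s,0},\\ \langle E_{sm}\mathbf u_s^h-\mathbf u_m^h(\hat{\mathbf x}_m),\mathbf w_s^h\rangle_{\Gamma^c_{s,h}}&=0&&\forall\,\mathbf w_s^h\in\mathbf W^h_s,\\ a^h_m(\mathbf u_m^h,\mathbf v_m^h)-\langle\overline\sigma_s(\mathbf u_s^h)\mathbf n_m,\mathbf v_m^h\rangle_{\Gamma^c_{m,h}}&=\langle\mathbf f_m,\mathbf v_m^h\rangle_{\Omega_{m,h}}&&\forall\,\mathbf v_m^h\in\mathbf V^h_m. \end{aligned} $$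
   Context: Geometry. For $i=s,m$, $\Omega_{i,h}\subset\mathbb R^2$ is a (polygonal, Lipschitz) domain with a conforming triangulation of mesh size $h_i$; $h=\max\{h_s,h_m\}$. $\Gamma^c_{i,h}\subset\partial\Omega_{i,h}$ is a simply connected polygonal curve made of mesh edges (the discrete interface of $\Omega_{i,h}$), and $\Gamma_{i,h}=\partial\Omega_{i,h}\setminus\Gamma^c_{i,h}$. The curves $\Gamma^c_{s,h}$ and $\Gamma^c_{m,h}$ need not coincide in space. $\mathbf n_m$ is the outward unit normal of $\partial\Omega_{m,h}$. There are given (measurable) maps $\phi_{sm}:\Gamma^c_{s,h}\to\Gamma^c_{m,h}$ and $\phi_{ms}:\Gamma^c_{m,h}\to\Gamma^c_{s,h}$ with $\sup_{\mathbf x_s\in\Gamma^c_{s,h}}d(\mathbf x_s,\phi_{sm}(\mathbf x_s))\le Ch$ and $\sup_{\mathbf x_m\in\Gamma^c_{m,h}}d(\mathbf x_m,\phi_{ms}(\mathbf x_m))\le Ch$ for a constant $C$. Write $\hat{\mathbf x}_m=\phi_{sm}(\mathbf x_s)$ and $\hat{\mathbf x}_s=\phi_{ms}(\mathbf x_m)$. Spaces. $V^h_i$ is the space of continuous functions on $\overline{\Omega_{i,h}}$, affine on each triangle, vanishing on $\Gamma_{i,h}$; $V^h_{i,0}$ is the subspace of those vanishing on all of $\partial\Omega_{i,h}$; $W^h_s$ is the space of continuous functions on $\Gamma^c_{s,h}$, affine on each edge, vanishing at the endpoints (a subspace of $H^{1/2}_{00}(\Gamma^c_{s,h})$). $\mathbf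 V^h_i=(V^h_i)^2$, $\mathbf V^h_{i,0}=(V^h_{i,0})^2$, $\mathbf W^h_s=(W^h_s)^2$. Convergence in the finite-dimensional spaces $\mathbf V^h_i$ is with respect to any norm; the $\mathbf g_k$ are functions in $L^2(\Gamma^c_{s,h})^2$ and converge in $L^2$. $\langle\cdot,\cdot\rangle_D$ denotes the integral over $D$ of the dot product. Elasticity. $\lambda_i,\mu_i$ are the (constant) Lamé parameters on $\Omega_{i,h}$; $\nabla\mathbf u$ is the Jacobian (row $j$ is the transposed gradient of $u_j$); $\varepsilon(\mathbf u)=\tfrac12(\nabla\mathbf u+(\nabla\mathbf u)^T)$; $\sigma_i(\mathbf u)=\lambda_i\,\mathrm{tr}(\varepsilon(\mathbf u))\,\mathbf I+2\mu_i\,\varepsilon(\mathbf u)$; $a^h_i(\mathbf v,\mathbf w)=\int_{\Omega_{i,h}}\sigma_i(\mathbf v):\varepsilon(\mathbf w)\,dx$. $\mathbf f_i\in L^2(\Omega_{i,h})^2$ is the external force. Taylor extension operators. For a piecewise linear vector function $\mathbf v$ on $\Omega_{s,h}$, $E_{sm}\mathbf v(\mathbf x_s)=\mathbf v(\mathbf x_s)+\nabla\mathbf v(\mathbf x_s)(\hat{\mathbf x}_m-\mathbf x_s)$ for (almost every) $\mathbf x_s\in\Gamma^c_{s,h}$, where $\nabla \mathbf v$ is taken from the triangle adjacent to the boundary edge. For a $2\times2$-matrix-valued, continuous piecewise linear function $J$ near $\Gamma^c_{s,h}$ in $\Omega_{s,h}$, and $\mathbf x_m\in\Gamma^c_{m,h}$,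 $$\mathbf E_{sm}J(\mathbf x_m)=J(\hat{\mathbf x}_s)+\bigl[\,\partial_xJ(\hat{\mathbf x}_s)(\mathbf x_m-\hat{\mathbf x}_s),\ \partial_yJ(\hat{\mathbf x}_s)(\mathbf x_m-\hat{\mathbf x}_s)\,\bigr],$$ where the bracket is the $2\times 2$ matrix with the two indicated columns, and derivatives of $J$ at a point are taken from a fixed adjacent triangle. Gradient recovery (Zhang–Naga). Let $\overline{\mathcal T}_{s,h}$ be the set of triangles of $\Omega_{s,h}$ containing a node of $\Gamma^c_{s,h}$. For a node $z_0=(x_0,y_0)$ of $\overline{\mathcal T}_{s,h}$, let $\mathcal K^0_{z_0}$ be the set of triangles of $\overline{\mathcal T}_{s,h}$ containing $z_0$, and let $\mathcal K^i_{z_0}$ be the set of triangles of $\overline{\mathcal T}_{s,h}$ containing some node of a triangle in $\mathcal K^{i-1}_{z_0}$. The patch $\mathcal K_{z_0}$ is the first $\mathcal K^i_{z_0}$ having more than $6$ nodes. Let $z_0,\dots,z_Z$ be the nodes of $\mathcal K_{z_0}$. For a continuous piecewise linear scalar function $v$, let $p_{z_0}$ be the polynomial of degree at most $2$ that is the least-squares fit to the values $v(z_0),\dots,v(z_Z)$ at the nodes $z_0,\dots,z_Z$ (the patches are assumed such that these exist and the fit is unique). The recovered gradient $G_hv$ is the continuous piecewise linear vector function on $\overline{\mathcal T}_{s,h}$ whose value at each node $z_0$ is $\nabla p_{z_0}(x_0,y_0)$. For $\mathbf v=(v_1,v_2)^T$, $\mathbf G_h\mathbf v$ is the $2\times2$-matrix-valued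 function with rows $(G_hv_1)^T$, $(G_hv_2)^T$. Extended strain and stress on $\Gamma^c_{m,h}$: $\overline\varepsilon(\mathbf v)=\tfrac12\{\mathbf E_{sm}(\mathbf G_h\mathbf v)+[\mathbf E_{sm}(\mathbf G_h\mathbf v)]^T\}$ and $\overline\sigma_s(\mathbf v)=\lambda_s\,\mathrm{tr}(\overline\varepsilon(\mathbf v))\,\mathbf I+2\mu_s\,\overline\varepsilon(\mathbf v)$. *)

theory Defs
  imports "HOL-Analysis.Analysis"
begin

section \<open>Triangulated domains and discrete interfaces\<close>

type_synonym point = "real^2"

(* A bounded domain lying locally on one side of the graph of a Lipschitz function,
   up to an isometric change of coordinates. *)
definition lipschitz_domain :: "point set \<Rightarrow> bool" where
  "lipschitz_domain \<Omega> \<longleftrightarrow> open \<Omega> \<and> connected \<Omega> \<and> bounded \<Omega> \<and> \<Omega> \<noteq> {} \<and>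
     (\<forall>p\<in>frontier \<Omega>. \<exists>(R :: point \<Rightarrow> point) L (\<gamma> :: real \<Rightarrow> real) r.
        orthogonal_transformation R \<and> L-lipschitz_on UNIV \<gamma> \<and> r > 0 \<and>
        \<Omega> \<inter> ball p r = {x \<in> ball p r. \<gamma> (R x $ 1) < R x $ 2})"

(* The discrete interface is stored as the list of its consecutive nodes. *)
record body =
  region :: "point set"
  tris :: "point set set"
  chain :: "point list"
  lame_lambda :: real
  lame_mu :: real

definition segs :: "point list \<Rightarrow> (point \<times> point) list" where
  "segs zs = zip zs (tl zs)"

definition interface :: "body \<Rightarrow> point set" where
  "interface D = (\<Union>(a, b)\<in>set (segs (chain D)). closed_segment a b)"

definition outer_boundary :: "body \<Rightarrow> point set" where
  "outer_boundary D = frontier (region D) - interface D"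

(* Since the triangulation is conforming, a chain of mesh edges through pairwise distinct
   nodes is a simple, non-closed polygonal curve. *)
definition triangulated_body :: "body \<Rightarrow> bool" where
  "triangulated_body D \<longleftrightarrow>
     lipschitz_domain (region D) \<and>
     triangulation (tris D) \<and> (\<forall>K\<in>tris D. 2 simplex K) \<and> \<Union>(tris D) = closure (region D) \<and>
     2 \<le> length (chain D) \<and> distinct (chain D) \<and>
     (\<forall>(a, b)\<in>set (segs (chain D)).
        (\<exists>K\<in>tris D. closed_segment a b edge_of K) \<and> closed_segment a b \<subseteq> frontier (region D))"

definition mesh_size :: "body \<Rightarrow> real" where
  "mesh_size D = Max (diameter ` tris D)"

(* The unit normal n for which the domain coincides with the half space below the
   boundary tangent near x; on a polygonal domain this determines n at every boundary
   point except the corners. *)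
definition outward_normal :: "point set \<Rightarrow> point \<Rightarrow> point" where
  "outward_normal \<Omega> x =
     (THE n. norm n = 1 \<and> (\<exists>r>0. \<Omega> \<inter> ball x r = {y \<in> ball x r. (y - x) \<bullet> n < 0}))"


section \<open>Arc length, square-integrable functions and pairings\<close>

definition segment_length_measure :: "point \<Rightarrow> point \<Rightarrow> point measure" where
  "segment_length_measure a b =
     scale_measure (ennreal (dist a b)) (distr (lebesgue_on {0..1}) borel (linepath a b))"

(* The completed arc-length measure on the plane concentrated on the polygonal chain:
   values of functions off the interface are irrelevant. *)
definition arclength :: "point list \<Rightarrow> point measure" where
  "arclength zs = completion (measure_of UNIV (sets borel)
     (\<lambda>A. \<Sum>(a, b)\<leftarrow>segs zs. emeasure (segment_length_measure a b) A))"

abbreviation interface_measure :: "body \<Rightarrow> point measure" where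
  "interface_measure D \<equiv> arclength (chain D)"

abbreviation region_measure :: "body \<Rightarrow> point measure" where
  "region_measure D \<equiv> lebesgue_on (region D)"

definition L2 :: "point measure \<Rightarrow> (point \<Rightarrow> real^2) set" where
  "L2 M = {f \<in> borel_measurable M. integrable M (\<lambda>x. (norm (f x))\<^sup>2)}"

definition L2_dist :: "point measure \<Rightarrow> (point \<Rightarrow> real^2) \<Rightarrow> (point \<Rightarrow> real^2) \<Rightarrow> real" where
  "L2_dist M f g = sqrt (LINT x|M. (norm (f x - g x))\<^sup>2)"

definition pairing :: "point measure \<Rightarrow> (point \<Rightarrow> real^2) \<Rightarrow> (point \<Rightarrow> real^2) \<Rightarrow> real" where
  "pairing M f g = (LINT x|M. f x \<bullet> g x)"


section \<open>Finite element spaces\<close>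

(* Members of the spaces are total functions; only their values on the closed domain
   (respectively on the interface) matter. *)

definition affine_fun_on :: "point set \<Rightarrow> (point \<Rightarrow> 'a::real_vector) \<Rightarrow> bool" where
  "affine_fun_on K f \<longleftrightarrow> (\<exists>L c. linear L \<and> (\<forall>x\<in>K. f x = L x + c))"

definition P1_space :: "body \<Rightarrow> (point \<Rightarrow> real) set" where
  "P1_space D = {v. continuous_on (closure (region D)) v \<and> (\<forall>K\<in>tris D. affine_fun_on K v)}"

definition V_space :: "body \<Rightarrow> (point \<Rightarrow> real) set" where
  "V_space D = {v \<in> P1_space D. \<forall>x\<in>outer_boundary D. v x = 0}"

definition V0_space :: "body \<Rightarrow> (point \<Rightarrow> real) set" where
  "V0_space D = {v \<in> V_space D. \<forall>x\<in>frontier (region D). v x = 0}"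

definition W_space :: "body \<Rightarrow> (point \<Rightarrow> real) set" where
  "W_space D = {w. continuous_on (interface D) w \<and>
     (\<forall>(a, b)\<in>set (segs (chain D)). affine_fun_on (closed_segment a b) w) \<and>
     w (hd (chain D)) = 0 \<and> w (last (chain D)) = 0}"

definition vec_fields :: "(point \<Rightarrow> real) set \<Rightarrow> (point \<Rightarrow> real^2) set" where
  "vec_fields S = {v. \<forall>i. (\<lambda>x. v x $ i) \<in> S}"


section \<open>Elasticity\<close>

definition strain :: "real^2^2 \<Rightarrow> real^2^2" where
  "strain A = (1/2) *\<^sub>R (A + transpose A)"

definition stress :: "body \<Rightarrow> real^2^2 \<Rightarrow> real^2^2" where
  "stress D E = (lame_lambda D * trace E) *\<^sub>R mat 1 + (2 * lame_mu D) *\<^sub>R E"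

(* The inner product on matrices is the Frobenius product. *)
definition elastic_form :: "body \<Rightarrow> (point \<Rightarrow> real^2) \<Rightarrow> (point \<Rightarrow> real^2) \<Rightarrow> real" where
  "elastic_form D v w = (LINT x|region_measure D.
     stress D (strain (jacobian v (at x))) \<bullet> strain (jacobian w (at x)))"


section \<open>Taylor extension operators\<close>

(* A choice of an adjacent triangle at every interface point; only at the finitely many
   nodes is there more than one candidate. *)
definition adjacent_choice :: "body \<Rightarrow> (point \<Rightarrow> point set) \<Rightarrow> bool" where
  "adjacent_choice D \<tau> \<longleftrightarrow> (\<forall>x\<in>interface D. \<tau> x \<in> tris D \<and> x \<in> \<tau> x)"

definition trace_grad :: "(point \<Rightarrow> point set) \<Rightarrow> (point \<Rightarrow> real^2) \<Rightarrow> point \<Rightarrow> real^2^2" where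
  "trace_grad \<tau> v x = jacobian v (at x within \<tau> x)"

definition extend_vec ::
    "(point \<Rightarrow> point set) \<Rightarrow> (point \<Rightarrow> point) \<Rightarrow> (point \<Rightarrow> real^2) \<Rightarrow> point \<Rightarrow> real^2" where
  "extend_vec \<tau> \<phi>sm v x = v x + trace_grad \<tau> v x *v (\<phi>sm x - x)"

(* Column j of the correction is the j-th partial derivative of J applied to x - \<phi>ms x. *)
definition extend_mat ::
    "(point \<Rightarrow> point set) \<Rightarrow> (point \<Rightarrow> point) \<Rightarrow> (point \<Rightarrow> real^2^2) \<Rightarrow> point \<Rightarrow> real^2^2" where
  "extend_mat \<tau> \<phi>ms J x = J (\<phi>ms x) +
     (\<chi> i j. (frechet_derivative J (at (\<phi>ms x) within \<tau> (\<phi>ms x)) (axis j 1)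
                *v (x - \<phi>ms x)) $ i)"


section \<open>Gradient recovery\<close>

definition nodes :: "point set set \<Rightarrow> point set" where
  "nodes T = {z. \<exists>K\<in>T. z extreme_point_of K}"

definition interface_tris :: "body \<Rightarrow> point set set" where
  "interface_tris D = {K \<in> tris D. \<exists>z\<in>nodes (tris D) \<inter> interface D. z \<in> K}"

fun layer :: "body \<Rightarrow> point \<Rightarrow> nat \<Rightarrow> point set set" where
  "layer D z 0 = {K \<in> interface_tris D. z \<in> K}"
| "layer D z (Suc i) = {K \<in> interface_tris D. \<exists>y\<in>nodes (layer D z i). y \<in> K}"

definition patch :: "body \<Rightarrow> point \<Rightarrow> point set set" where
  "patch D z = layer D z (LEAST i. card (nodes (layer D z i)) > 6)"

definition quadratics :: "(point \<Rightarrow> real) set" where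
  "quadratics = {p. \<exists>a b c d e f. \<forall>x. p x =
     a + b * x$1 + c * x$2 + d * (x$1)\<^sup>2 + e * (x$1 * x$2) + f * (x$2)\<^sup>2}"

definition fit_error :: "body \<Rightarrow> (point \<Rightarrow> real) \<Rightarrow> point \<Rightarrow> (point \<Rightarrow> real) \<Rightarrow> real" where
  "fit_error D v z p = (\<Sum>y\<in>nodes (patch D z). (p y - v y)\<^sup>2)"

definition quadratic_fit :: "body \<Rightarrow> (point \<Rightarrow> real) \<Rightarrow> point \<Rightarrow> (point \<Rightarrow> real)" where
  "quadratic_fit D v z = (THE p. is_arg_min (fit_error D v z) (\<lambda>p. p \<in> quadratics) p)"

definition admissible_patches :: "body \<Rightarrow> bool" where
  "admissible_patches D \<longleftrightarrow> (\<forall>z\<in>nodes (interface_tris D).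
     (\<exists>i. card (nodes (layer D z i)) > 6) \<and>
     (\<forall>v\<in>P1_space D. \<exists>!p. is_arg_min (fit_error D v z) (\<lambda>p. p \<in> quadratics) p))"

definition grad :: "(point \<Rightarrow> real) \<Rightarrow> point \<Rightarrow> real^2" where
  "grad p z = (\<chi> i. frechet_derivative p (at z) (axis i 1))"

(* Extension by 0 off the triangles only serves to make the function unique. *)
definition recovered_grad :: "body \<Rightarrow> (point \<Rightarrow> real) \<Rightarrow> point \<Rightarrow> real^2" where
  "recovered_grad D v = (THE G.
     continuous_on (\<Union>(interface_tris D)) G \<and>
     (\<forall>K\<in>interface_tris D. affine_fun_on K G) \<and>
     (\<forall>z\<in>nodes (interface_tris D). G z = grad (quadratic_fit D v z) z) \<and>
     (\<forall>x. x \<notin> \<Union>(interface_tris D) \<longrightarrow> G x = 0))"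

definition recovered_jacobian :: "body \<Rightarrow> (point \<Rightarrow> real^2) \<Rightarrow> point \<Rightarrow> real^2^2" where
  "recovered_jacobian D v x = (\<chi> i. recovered_grad D (\<lambda>y. v y $ i) x)"

definition extended_stress ::
    "body \<Rightarrow> (point \<Rightarrow> point set) \<Rightarrow> (point \<Rightarrow> point) \<Rightarrow> (point \<Rightarrow> real^2) \<Rightarrow> point \<Rightarrow> real^2^2" where
  "extended_stress D \<tau> \<phi>ms v x =
     stress D (strain (extend_mat \<tau> \<phi>ms (recovered_jacobian D v) x))"

end

theory Submission
  imports Defs
begin

text \<open>The iteration is passed to the limit term by term. Every term of the discrete equations is a
  linear functional of a finite element field that only depends on its nodal values, so it is a finite
  sum over the hat functions and pointwise convergence at the nodes is enough. What has to be proved is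
  linearity, i.e. integrability of all integrands. This rests on the geometry: since a Lipschitz
  domain is the interior of its closure, an open interface edge belongs to exactly one triangle, so the
  adjacent triangle and the outward normal are constant along it. The recovered gradient is linear
  because least-squares fits are characterised by orthogonality and the interpolant of nodal values is
  unique. The fixed-point relation for the limit of g then turns into the Taylor coupling
  condition.\<close>

section \<open>Piecewise affine functions on triangulations\<close>

text \<open>The delicate point is composition with \<open>\<phi>sm\<close> and
  \<open>\<phi>ms\<close>. They are only measurable, so they may send a set of positive length into
  a single node, and a statement that holds almost everywhere on one interface does not pull back to
  the other. Integrands composed with them are therefore controlled at every point of the interface,
  nodes included (\<open>piecewise_bounded\<close>), and only the result is an almost-everywhere
  statement (\<open>ess_bounded\<close>). Fields are total functions with arbitrary values off the
  closed domain, and a functional must ignore these values before a field can be replaced by its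
  nodal expansion. The descriptions behind \<open>outward_normal\<close> and
  \<open>measure_of\<close> are never evaluated: the normal is only shown to take one value per open
  edge, and arc length is only bounded from above. The iterates \<open>g k\<close> are the one
  ingredient without finite element structure; they enter the limit only through their pairings with
  bounded test functions, by Cauchy-Schwarz.\<close>

lemma affine_fun_on_add:
  "affine_fun_on K f \<Longrightarrow> affine_fun_on K g \<Longrightarrow> affine_fun_on K (\<lambda>x. f x + g x)"
  unfolding affine_fun_on_def
proof (elim exE conjE)
  fix L c L' c' assume "linear L" "linear L'" "\<forall>x\<in>K. f x = L x + c" "\<forall>x\<in>K. g x = L' x + c'"
  then show "\<exists>L c. linear L \<and> (\<forall>x\<in>K. f x + g x = L x + c)"
    by (intro exI[of _ "\<lambda>x. L x + L' x"] exI[of _ "c + c'"]) (auto intro: linear_compose_add)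
qed

lemma affine_fun_on_linear_image:
  "affine_fun_on K f \<Longrightarrow> linear T \<Longrightarrow> affine_fun_on K (\<lambda>x. T (f x))"
  unfolding affine_fun_on_def
proof (elim exE conjE)
  fix L c assume "linear T" "linear L" "\<forall>x\<in>K. f x = L x + c"
  then show "\<exists>L c. linear L \<and> (\<forall>x\<in>K. T (f x) = L x + c)"
    by (intro exI[of _ "\<lambda>x. T (L x)"] exI[of _ "T c"])
      (auto simp: linear_add linear_compose[unfolded o_def])
qed

lemma affine_fun_on_scaleR: "affine_fun_on K f \<Longrightarrow> affine_fun_on K (\<lambda>x. c *\<^sub>R f x)"
  by (rule affine_fun_on_linear_image) (auto simp: linear_iff algebra_simps)

lemma affine_fun_on_zero: "affine_fun_on K (\<lambda>x. 0)"
  unfolding affine_fun_on_def by (intro exI[of _ "\<lambda>x. 0"] exI[of _ 0]) (auto simp: linear_iff)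

lemma affine_fun_on_sum:
  "(\<And>i. i \<in> I \<Longrightarrow> affine_fun_on K (f i)) \<Longrightarrow> affine_fun_on K (\<lambda>x. \<Sum>i\<in>I. f i x)"
  by (induction I rule: infinite_finite_induct) (auto intro: affine_fun_on_add affine_fun_on_zero)

lemma affine_fun_on_cong:
  "affine_fun_on K f \<Longrightarrow> (\<And>x. x \<in> K \<Longrightarrow> f x = g x) \<Longrightarrow> affine_fun_on K g"
  unfolding affine_fun_on_def by metis

lemma affine_fun_on_subset: "affine_fun_on K f \<Longrightarrow> A \<subseteq> K \<Longrightarrow> affine_fun_on A f"
  unfolding affine_fun_on_def by blast

text \<open>Within the hull the two functions agree exactly where the linear map \<open>h\<close>
  takes one fixed value, and the preimage of a point under a linear map is convex; containing
  \<open>C\<close>, it contains the hull.\<close>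

lemma affine_fun_on_eq_on_hull:
  assumes "affine_fun_on (convex hull C) f" "affine_fun_on (convex hull C) g"
    and "\<And>x. x \<in> C \<Longrightarrow> f x = g x" "x \<in> convex hull C"
  shows "f x = g x"
proof -
  obtain L c L' c' where L: "linear L" "\<forall>x\<in>convex hull C. f x = L x + c"
    and L': "linear L'" "\<forall>x\<in>convex hull C. g x = L' x + c'"
    using assms(1,2) unfolding affine_fun_on_def by blast
  define h where "h = (\<lambda>x. L x - L' x)"
  have h: "linear h" unfolding h_def using L L' by (intro linear_compose_sub)
  have "convex (h -` {c' - c})" by (intro convex_linear_vimage h) auto
  moreover have "C \<subseteq> h -` {c' - c}"
  proof
    fix y assume "y \<in> C"
    then have "L y + c = L' y + c'"
      using L(2) L'(2) assms(3) hull_inc[of y C convex] by metis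
    then show "y \<in> h -` {c' - c}" by (simp add: h_def algebra_simps)
  qed
  ultimately have "convex hull C \<subseteq> h -` {c' - c}" by (simp add: hull_minimal)
  then have "h x = c' - c" using assms(4) by auto
  then show ?thesis using L(2) L'(2) assms(4) by (simp add: h_def algebra_simps)
qed

text \<open>Moving one vertex \<open>a\<close> to the origin turns affine independence of
  \<open>C\<close> into linear independence, and a linear map may be prescribed freely on an
  independent set.\<close>

lemma affine_interpolation_exists:
  fixes C :: "'a::euclidean_space set" and r :: "'a \<Rightarrow> 'b::real_vector"
  assumes "\<not> affine_dependent C"
  obtains L c where "linear L" "\<And>x. x \<in> C \<Longrightarrow> L x + c = r x"
proof (cases "C = {}")
  case True
  show ?thesis by (rule that[of "\<lambda>x. 0" 0]) (auto simp: True linear_iff)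
next
  case False
  then obtain a where a: "a \<in> C" by blast
  define B where "B = (\<lambda>x. - a + x) ` (C - {a})"
  have "independent B" using assms a unfolding B_def
    by (metis affine_dependent_iff_dependent2)
  \<comment> \<open>Elements of \<open>B\<close> are vertices shifted by \<open>- a\<close>; the
    prescribed value undoes the shift and subtracts the value at \<open>a\<close>, which the
    constant \<open>r a - L a\<close> restores.\<close>
  then obtain L where L: "linear L" "\<forall>x\<in>B. L x = r (x + a) - r a"
    using linear_independent_extend[of B "\<lambda>x. r (x + a) - r a"] by blast
  show ?thesis
  proof (rule that[of L "r a - L a"])
    fix x assume x: "x \<in> C"
    show "L x + (r a - L a) = r x"
    proof (cases "x = a")
      case False
      then have "- a + x \<in> B" using x by (auto simp: B_def)
      then have "L (- a + x) = r x - r a" using L(2) by auto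
      then show ?thesis using L(1) by (simp add: linear_diff algebra_simps)
    qed simp
  qed fact
qed

section \<open>Simplices, nodes and nodal interpolation\<close>

lemma simplex_eq_hull_extreme_points:
  "n simplex K \<Longrightarrow> K = convex hull {x. x extreme_point_of K}"
  by (intro Krein_Milman_Minkowski compact_simplex convex_simplex)

lemma simplex_affine_interpolation:
  fixes K :: "'a::euclidean_space set"
  assumes "n simplex K"
  obtains L c where "linear L" "\<And>x. x extreme_point_of K \<Longrightarrow> L x + c = r x"
proof -
  obtain C where C: "\<not> affine_dependent C" "K = convex hull C"
    using assms unfolding simplex_def by blast
  obtain L c where "linear L" "\<And>x. x \<in> C \<Longrightarrow> L x + c = r x"
    using affine_interpolation_exists[OF C(1)] by blast
  then show ?thesis using that extreme_point_of_convex_hull_affine_independent[OF C(1)] C(2)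
    by blast
qed

lemma finite_extreme_points_simplex: "n simplex K \<Longrightarrow> finite {x. x extreme_point_of K}"
  unfolding simplex using extreme_points_of_convex_hull finite_subset by metis

lemma triangulationD:
  assumes "triangulation T"
  shows "finite T" "K \<in> T \<Longrightarrow> \<exists>n. n simplex K" "K \<in> T \<Longrightarrow> compact K" "K \<in> T \<Longrightarrow> convex K"
    "K \<in> T \<Longrightarrow> K' \<in> T \<Longrightarrow> (K \<inter> K') face_of K" "K \<in> T \<Longrightarrow> K' \<in> T \<Longrightarrow> (K \<inter> K') face_of K'"
  using assms unfolding triangulation_def
  by (auto intro: compact_simplex convex_simplex)
    (use assms in \<open>auto simp: triangulation_def Int_commute[of K] \<close>)

lemma nodes_subset_Union: "nodes T \<subseteq> \<Union>T"
  by (auto simp: nodes_def extreme_point_of_def)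

lemma finite_nodes: "triangulation T \<Longrightarrow> finite (nodes T)"
  unfolding nodes_def
proof -
  assume T: "triangulation T"
  have "{z. \<exists>K\<in>T. z extreme_point_of K} = (\<Union>K\<in>T. {z. z extreme_point_of K})" by auto
  moreover have "finite {z. z extreme_point_of K}" if "K \<in> T" for K
    using triangulationD(2)[OF T that] finite_extreme_points_simplex by blast
  ultimately show "finite {z. \<exists>K\<in>T. z extreme_point_of K}"
    using triangulationD(1)[OF T] by simp
qed

text \<open>Each simplex is the hull of its own extreme points, so the argument stays in one
  \<open>K\<close> and asks for no continuity between simplices. It gives both uniqueness of the
  recovered gradient and the hat expansion.\<close>

lemma piecewise_affine_unique:
  assumes T: "triangulation T"
    and f: "\<And>K. K \<in> T \<Longrightarrow> affine_fun_on K f" and g: "\<And>K. K \<in> T \<Longrightarrow> affine_fun_on K g"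
    and eq: "\<And>z. z \<in> nodes T \<Longrightarrow> f z = g z" and x: "x \<in> \<Union>T"
  shows "f x = g x"
proof -
  obtain K where K: "K \<in> T" "x \<in> K" using x by blast
  have h: "K = convex hull {x. x extreme_point_of K}"
    using triangulationD(2)[OF T K(1)] simplex_eq_hull_extreme_points by blast
  show ?thesis
  proof (rule affine_fun_on_eq_on_hull[of "{x. x extreme_point_of K}"], unfold h[symmetric])
    show "f y = g y" if "y \<in> {x. x extreme_point_of K}" for y
      using that K(1) eq by (auto simp: nodes_def)
  qed (use f g K in auto)
qed

lemma affine_fun_on_imp_continuous_on:
  fixes f :: "point \<Rightarrow> 'b::real_normed_vector"
  assumes "affine_fun_on K f" shows "continuous_on K f"
proof -
  obtain L c where L: "linear L" "\<forall>x\<in>K. f x = L x + c"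
    using assms unfolding affine_fun_on_def by blast
  have "continuous_on K (\<lambda>x. L x + c)"
    using L(1) by (intro continuous_intros linear_continuous_on) (simp add: linear_conv_bounded_linear)
  then show ?thesis using L(2) by (simp cong: continuous_on_cong)
qed

lemma piecewise_affine_continuous_on:
  fixes f :: "point \<Rightarrow> 'b::real_normed_vector"
  assumes T: "triangulation T" and "\<And>K. K \<in> T \<Longrightarrow> affine_fun_on K f"
  shows "continuous_on (\<Union>T) f"
proof -
  have "continuous_on (\<Union>K\<in>T. K) f"
    by (rule continuous_on_closed_Union)
      (use assms triangulationD[OF T] in
        \<open>auto intro: affine_fun_on_imp_continuous_on compact_imp_closed\<close>)
  then show ?thesis by simp
qed

text \<open>The interpolants on two simplices agree on the common face because they agree at its
  extreme points, which are vertices of both.\<close>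

lemma piecewise_affine_interpolation:
  fixes r :: "point \<Rightarrow> 'b::real_normed_vector"
  assumes T: "triangulation T"
  shows "\<exists>G. continuous_on (\<Union>T) G \<and> (\<forall>K\<in>T. affine_fun_on K G) \<and> (\<forall>z\<in>nodes T. G z = r z) \<and>
    (\<forall>x. x \<notin> \<Union>T \<longrightarrow> G x = 0)"
proof -
  have "\<exists>f. affine_fun_on UNIV f \<and> (\<forall>z. z extreme_point_of K \<longrightarrow> f z = r z)" if "K \<in> T" for K
  proof -
    obtain n where "n simplex K" using triangulationD(2)[OF T \<open>K \<in> T\<close>] by blast
    then obtain L c where "linear L" "\<And>x. x extreme_point_of K \<Longrightarrow> L x + c = r x"
      by (rule simplex_affine_interpolation[where r = r]) blast
    then show ?thesis unfolding affine_fun_on_def by (intro exI[of _ "\<lambda>x. L x + c"]) auto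
  qed
  then obtain F where F: "\<And>K. K \<in> T \<Longrightarrow> affine_fun_on UNIV (F K)"
    "\<And>K z. K \<in> T \<Longrightarrow> z extreme_point_of K \<Longrightarrow> F K z = r z"
    by metis
  have cons: "F K x = F K' x" if K: "K \<in> T" "K' \<in> T" "x \<in> K" "x \<in> K'" for K K' x
  proof -
    let ?F = "K \<inter> K'"
    have "compact ?F" "convex ?F"
      using triangulationD(3,4)[OF T] K by (auto intro: compact_Int convex_Int)
    then have hull: "?F = convex hull {z. z extreme_point_of ?F}"
      by (rule Krein_Milman_Minkowski)
    show ?thesis
    proof (rule affine_fun_on_eq_on_hull[of "{z. z extreme_point_of ?F}"], unfold hull[symmetric])
      fix z assume "z \<in> {z. z extreme_point_of ?F}"
      then have "z extreme_point_of K" "z extreme_point_of K'"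
        using extreme_point_of_face triangulationD(5,6)[OF T K(1,2)] by auto
      then show "F K z = F K' z" using F K by metis
    qed (use affine_fun_on_subset[OF F(1)[OF K(1)]] affine_fun_on_subset[OF F(1)[OF K(2)]] K in simp_all)
  qed
  \<comment> \<open>By \<open>cons\<close> the value does not depend on the simplex chosen around
    \<open>x\<close>; zero elsewhere matches the convention of
    \<open>recovered_grad\<close>.\<close>
  define G where "G x = (if x \<in> \<Union>T then F (SOME K. K \<in> T \<and> x \<in> K) x else 0)" for x
  have G: "G x = F K x" if "K \<in> T" "x \<in> K" for K x
  proof -
    have K': "(SOME K. K \<in> T \<and> x \<in> K) \<in> T \<and> x \<in> (SOME K. K \<in> T \<and> x \<in> K)"
      by (rule someI_ex) (use that in blast)
    have "x \<in> \<Union>T" using that by blast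
    then have "G x = F (SOME K. K \<in> T \<and> x \<in> K) x" by (simp only: G_def if_True)
    also have "\<dots> = F K x" by (rule cons) (use K' that in simp_all)
    finally show ?thesis .
  qed
  have aff: "affine_fun_on K G" if "K \<in> T" for K
    by (rule affine_fun_on_cong[of K "F K"])
      (use affine_fun_on_subset[OF F(1)[OF that]] that G in auto)
  show ?thesis
  proof (intro exI[of _ G] conjI ballI)
    show "continuous_on (\<Union>T) G" by (rule piecewise_affine_continuous_on[OF T aff])
    show "G z = r z" if "z \<in> nodes T" for z
    proof -
      obtain K where K: "K \<in> T" "z extreme_point_of K" using \<open>z \<in> nodes T\<close> unfolding nodes_def by auto
      then have "z \<in> K" by (simp add: extreme_point_of_def)
      then show ?thesis using G F(2) K by simp
    qed
  qed (auto simp: aff G_def)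
qed

text \<open>At a corner of a convex set the difference quotients only see a cone of directions, which
  still spans the whole space.\<close>

lemma frechet_derivative_within_affine:
  fixes f :: "point \<Rightarrow> 'b::real_normed_vector"
  assumes K: "convex K" "interior K \<noteq> {}" and x: "x \<in> K"
    and L: "linear L" "\<And>y. y \<in> K \<Longrightarrow> f y = L y + c"
  shows "frechet_derivative f (at x within K) = L"
proof -
  have "((\<lambda>y. L y + c) has_derivative L) (at x within K)"
    using L(1) by (auto intro!: derivative_eq_intros bounded_linear_imp_has_derivative
        simp: linear_conv_bounded_linear)
  then have "(f has_derivative L) (at x within K)"
    by (rule has_derivative_transform[rotated 2]) (use x L in auto)
  then have fd: "(f has_derivative frechet_derivative f (at x within K)) (at x within K)"
    using frechet_derivative_works differentiableI by blast
  \<comment> \<open>\<open>frechet_derivative\<close> merely selects some derivative, so uniqueness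
    has to be shown: the difference \<open>E\<close> of the selected one and \<open>L\<close> is a
    derivative of the zero function.\<close>
  define D where "D = frechet_derivative f (at x within K)"
  define E where "E = (\<lambda>h. D h - L h)"
  have "linear D" using fd unfolding D_def by (rule has_derivative_linear)
  then have linE: "linear E" unfolding E_def using L(1) by (rule linear_compose_sub)
  have "((\<lambda>y. f y - f y) has_derivative E) (at x within K)"
    unfolding E_def D_def by (rule has_derivative_diff) fact+
  then have zero: "((\<lambda>y. 0::'b) has_derivative E) (at x within K)" by simp
  \<comment> \<open>Along the segment from \<open>x\<close> to \<open>z\<close> the question becomes
    uniqueness of a one-sided derivative on \<open>{0..1}\<close>.\<close>
  have dir: "E (z - x) = 0" if z: "z \<in> K" for z
  proof -
    have "((\<lambda>t. x + t *\<^sub>R (z - x)) has_derivative (\<lambda>t. t *\<^sub>R (z - x))) (at 0 within {0..1})"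
      by (auto intro!: derivative_eq_intros)
    moreover have "(\<lambda>t. x + t *\<^sub>R (z - x)) ` {0..1} \<subseteq> K"
      using K(1) x z by (auto simp: convex_alt algebra_simps)
    ultimately have "(((\<lambda>y. 0::'b) \<circ> (\<lambda>t. x + t *\<^sub>R (z - x))) has_derivative
        E \<circ> (\<lambda>t. t *\<^sub>R (z - x))) (at 0 within {0..1})"
      by (intro diff_chain_within) (use zero in \<open>auto intro: has_derivative_subset\<close>)
    then have "((\<lambda>t. 0::'b) has_derivative (\<lambda>t. t *\<^sub>R E (z - x))) (at (0::real) within {0..1})"
      using linE by (simp add: o_def linear_scale)
    then have "((\<lambda>t. 0::'b) has_vector_derivative E (z - x)) (at (0::real) within {0..1})"
      by (simp add: has_vector_derivative_def)
    moreover have "((\<lambda>t. 0::'b) has_vector_derivative 0) (at (0::real) within {0..1})"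
      by (rule has_vector_derivative_const)
    ultimately show "E (z - x) = 0"
      by (intro vector_derivative_unique_within_closed_interval[of 0 1 0 "\<lambda>t. 0::'b"])
        (auto simp: box_real)
  qed
  obtain w e where w: "e > 0" "ball w e \<subseteq> K"
    using K(2) by (meson all_not_in_conv mem_interior)
  have "E h = 0" for h
  proof (cases "h = 0")
    case False
    \<comment> \<open>Half the radius of the ball in direction \<open>h\<close>; then
      \<open>s *\<^sub>R h\<close> is the difference of two points of \<open>K\<close> whose offsets
      from \<open>x\<close> are both annihilated by \<open>E\<close>.\<close>
    define s where "s = e / (2 * norm h)"
    have s: "s > 0" using False w(1) by (simp add: s_def)
    have "w + s *\<^sub>R h \<in> K" "w \<in> K"
      using w False by (auto intro!: subsetD[OF w(2)] simp: dist_norm s_def)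
    then have "E (w + s *\<^sub>R h - x) = 0" "E (w - x) = 0" using dir by auto
    then have "E (s *\<^sub>R h) = 0" using linE by (simp add: linear_add linear_diff)
    then show ?thesis using s linE by (simp add: linear_scale)
  qed (use linE linear_0 in blast)
  then show ?thesis unfolding E_def D_def by (simp add: fun_eq_iff)
qed

section \<open>Linearity of the derivative within a triangle\<close>

lemma frechet_derivative_within_add_affine:
  fixes f g :: "point \<Rightarrow> 'b::real_normed_vector"
  assumes K: "convex K" "interior K \<noteq> {}" "x \<in> K" and "affine_fun_on K f" "affine_fun_on K g"
  shows "frechet_derivative (\<lambda>y. f y + g y) (at x within K) =
    (\<lambda>h. frechet_derivative f (at x within K) h + frechet_derivative g (at x within K) h)"
proof -
  obtain L c L' c' where L: "linear L" "\<forall>x\<in>K. f x = L x + c"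
    and L': "linear L'" "\<forall>x\<in>K. g x = L' x + c'"
    using assms(4,5) unfolding affine_fun_on_def by blast
  have "frechet_derivative (\<lambda>y. f y + g y) (at x within K) = (\<lambda>h. L h + L' h)"
    by (rule frechet_derivative_within_affine[where c = "c + c'", OF K])
      (use L L' in \<open>auto intro: linear_compose_add\<close>)
  then show ?thesis
    using frechet_derivative_within_affine[OF K, of L f c] frechet_derivative_within_affine[OF K, of L' g c']
      L L' by auto
qed

lemma frechet_derivative_within_scaleR_affine:
  fixes f :: "point \<Rightarrow> 'b::real_normed_vector"
  assumes K: "convex K" "interior K \<noteq> {}" "x \<in> K" and "affine_fun_on K f"
  shows "frechet_derivative (\<lambda>y. r *\<^sub>R f y) (at x within K) =
    (\<lambda>h. r *\<^sub>R frechet_derivative f (at x within K) h)"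
proof -
  obtain L c where L: "linear L" "\<forall>x\<in>K. f x = L x + c"
    using assms(4) unfolding affine_fun_on_def by blast
  have "frechet_derivative (\<lambda>y. r *\<^sub>R f y) (at x within K) = (\<lambda>h. r *\<^sub>R L h)"
    by (rule frechet_derivative_within_affine[where c = "r *\<^sub>R c", OF K])
      (use L in \<open>auto intro: linear_compose_scale_right simp: algebra_simps\<close>)
  then show ?thesis using frechet_derivative_within_affine[OF K, of L f c] L by auto
qed

lemma frechet_derivative_within_const_affine:
  fixes f :: "point \<Rightarrow> 'b::real_normed_vector"
  assumes K: "convex K" "interior K \<noteq> {}" and "x \<in> K" "y \<in> K" and "affine_fun_on K f"
  shows "frechet_derivative f (at x within K) = frechet_derivative f (at y within K)"
proof -
  obtain L c where L: "linear L" "\<forall>x\<in>K. f x = L x + c"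
    using assms(5) unfolding affine_fun_on_def by blast
  then show ?thesis
    using frechet_derivative_within_affine[OF K, of _ L f c] assms(3,4) by auto
qed

section \<open>Geometry of the interface\<close>

text \<open>Excludes slits. Next to a point of \<open>interior (closure \<Omega>)\<close> missing
  from \<open>\<Omega>\<close>, the points below the local graph would form an open set disjoint
  from \<open>\<Omega>\<close>, hence from its closure, although it comes arbitrarily near that
  point.\<close>

lemma interior_closure_lipschitz_domain:
  assumes "lipschitz_domain \<Omega>"
  shows "interior (closure \<Omega>) = \<Omega>"
proof
  have op: "open \<Omega>" using assms by (simp add: lipschitz_domain_def)
  then show "\<Omega> \<subseteq> interior (closure \<Omega>)" by (simp add: closure_subset interior_maximal)
  show "interior (closure \<Omega>) \<subseteq> \<Omega>"
  proof
    fix p assume p: "p \<in> interior (closure \<Omega>)"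
    show "p \<in> \<Omega>"
    proof (rule ccontr)
      assume np: "p \<notin> \<Omega>"
      then have "p \<in> frontier \<Omega>"
        using p op interior_subset by (auto simp: frontier_def interior_open)
      then have "\<exists>(R :: point \<Rightarrow> point) L (\<gamma> :: real \<Rightarrow> real) r.
          orthogonal_transformation R \<and> L-lipschitz_on UNIV \<gamma> \<and> r > 0 \<and>
          \<Omega> \<inter> ball p r = {x \<in> ball p r. \<gamma> (R x $ 1) < R x $ 2}"
        using assms by (simp add: lipschitz_domain_def)
      then obtain R :: "point \<Rightarrow> point" and L \<gamma> r where R: "orthogonal_transformation R"
        and \<gamma>: "L-lipschitz_on UNIV (\<gamma> :: real \<Rightarrow> real)" and r: "r > 0"
        and graph: "\<Omega> \<inter> ball p r = {x \<in> ball p r. \<gamma> (R x $ 1) < R x $ 2}"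
        by (elim exE conjE)
      obtain e where e: "e > 0" "ball p e \<subseteq> closure \<Omega>" using p by (meson mem_interior)
      have linR: "linear R" using R by (rule orthogonal_transformation_linear)
      \<comment> \<open>\<open>d\<close> is the vertical direction of the local coordinates;
        \<open>q\<close> will lie straight below \<open>p\<close> and, with \<open>t\<close> at most
        half of either radius, in both balls.\<close>
      obtain d where d: "R d = axis 2 1" using orthogonal_transformation_surj[OF R] by (metis surjD)
      have nd: "norm d = 1" using orthogonal_transformation_norm[OF R, of d] d by (simp add: norm_axis_1)
      define t where "t = min e r / 2"
      have t: "t > 0" "t < e" "t < r" using e r by (auto simp: t_def)
      define q where "q = p - t *\<^sub>R d"
      have q: "q \<in> ball p e" "q \<in> ball p r" using nd t by (auto simp: q_def dist_norm)
      have Rq: "R q $ 1 = R p $ 1" "R q $ 2 = R p $ 2 - t"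
        using linR d by (auto simp: q_def linear_diff linear_scale axis_def)
      have "\<not> \<gamma> (R p $ 1) < R p $ 2" 
      proof
        assume "\<gamma> (R p $ 1) < R p $ 2"
        then have "p \<in> \<Omega> \<inter> ball p r" unfolding graph using r by simp
        then show False using np by blast
      qed
      then have below: "R q $ 2 < \<gamma> (R q $ 1)" using Rq t by simp
      have c\<gamma>: "continuous_on UNIV \<gamma>" using \<gamma> by (rule lipschitz_on_continuous_on)
      have cR: "continuous_on UNIV R" using linR by (simp add: linear_continuous_on linear_conv_bounded_linear)
      have "open {x. R x $ 2 < \<gamma> (R x $ 1)}"
        by (intro open_Collect_less continuous_on_compose2[OF c\<gamma>] continuous_intros cR) auto
      then have "open ({x. R x $ 2 < \<gamma> (R x $ 1)} \<inter> ball p r)" by blast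
      moreover have "({x. R x $ 2 < \<gamma> (R x $ 1)} \<inter> ball p r) \<inter> \<Omega> = {}"
      proof -
        have "\<not> R x $ 2 < \<gamma> (R x $ 1)" if "x \<in> \<Omega> \<inter> ball p r" for x
          using that unfolding graph by simp
        then show ?thesis by blast
      qed
      ultimately have "({x. R x $ 2 < \<gamma> (R x $ 1)} \<inter> ball p r) \<inter> closure \<Omega> = {}"
        using open_Int_closure_eq_empty by blast
      then show False using below q e(2) by blast
    qed
  qed
qed

text \<open>In the plane the vectors orthogonal to \<open>d\<close> form a line. This relates the
  edge normals that two triangles obtain separately.\<close>

lemma parallel_plane:
  fixes d m m' :: point
  assumes "d \<noteq> 0" "m \<noteq> 0" "m \<bullet> d = 0" "m' \<bullet> d = 0"
  obtains k where "m' = k *\<^sub>R m"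
proof -
  have eqs: "m$1 * d$1 + m$2 * d$2 = 0" "m'$1 * d$1 + m'$2 * d$2 = 0"
    using assms(3,4) by (auto simp: inner_vec_def sum_2)
  have z: "d$1 \<noteq> 0 \<or> d$2 \<noteq> 0" "m$1 \<noteq> 0 \<or> m$2 \<noteq> 0"
    using assms(1,2) by (auto simp: vec_eq_iff forall_2)
  \<comment> \<open>Elimination of one unknown at a time: each coordinate of \<open>d\<close> times
    the determinant of \<open>m'\<close> and \<open>m\<close> is a combination of the two
    orthogonality equations, and some coordinate of \<open>d\<close> is nonzero.\<close>
  have "d$1 * (m'$1 * m$2 - m'$2 * m$1) = m$2 * (m'$1 * d$1 + m'$2 * d$2) - m'$2 * (m$1 * d$1 + m$2 * d$2)"
    "d$2 * (m'$1 * m$2 - m'$2 * m$1) = m'$1 * (m$1 * d$1 + m$2 * d$2) - m$1 * (m'$1 * d$1 + m'$2 * d$2)"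
    by algebra+
  then have det: "m'$1 * m$2 = m'$2 * m$1" using eqs z(1) by auto
  show ?thesis
  proof (cases "m$1 = 0")
    case True
    then show ?thesis using det z(2)
      by (intro that[of "m'$2 / m$2"]) (auto simp: vec_eq_iff forall_2)
  next
    case False
    then show ?thesis using det
      by (intro that[of "m'$1 / m$1"]) (auto simp: vec_eq_iff forall_2 field_simps)
  qed
qed

section \<open>Triangles at a boundary edge\<close>

lemma interior_triangle_nonempty: "2 simplex (K :: point set) \<Longrightarrow> interior K \<noteq> {}"
proof -
  assume K: "2 simplex K"
  have "aff_dim K = 2" using K by (simp add: aff_dim_simplex)
  then have "rel_interior K = interior K"
    by (simp add: interior_rel_interior_gen)
  moreover have "K \<noteq> {}" using K by auto
  ultimately show ?thesis using convex_simplex[OF K] rel_interior_eq_empty by metis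
qed

text \<open>In the coordinates \<open>s\<close>, \<open>t\<close> along \<open>b - a\<close> and
  \<open>c - a\<close> the triangle is given by \<open>s \<ge> 0\<close>, \<open>t \<ge> 0\<close>,
  \<open>s + t \<le> 1\<close>. Inside the edge \<open>t = 0\<close> and \<open>0 < s < 1\<close>,
  so nearby only \<open>t \<ge> 0\<close> is active. The same \<open>m\<close> serves the whole open
  edge.\<close>

lemma simplex_half_disc:
  fixes K :: "point set"
  assumes K: "2 simplex K" and ab: "closed_segment a b edge_of K"
  obtains m where "m \<noteq> 0" "m \<bullet> (b - a) = 0"
    "\<And>x. x \<in> open_segment a b \<Longrightarrow> \<exists>r>0. K \<inter> ball x r = {y \<in> ball x r. (y - x) \<bullet> m \<le> 0}"
proof -
  obtain C where C: "\<not> affine_dependent C" "card C = 3" "K = convex hull C"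
    using K unfolding simplex_def by force
  have neq: "a \<noteq> b" using ab by (auto simp: edge_of_def)
  have face: "closed_segment a b face_of K" using ab by (simp add: edge_of_def)
  have "a extreme_point_of K" "b extreme_point_of K"
    using extreme_point_of_face[OF face] extreme_point_of_segment by blast+
  then have "a \<in> C" "b \<in> C" using C extreme_point_of_convex_hull_affine_independent by auto
  moreover have "card (C - {a,b}) = 1"
    using C(2) neq \<open>a \<in> C\<close> \<open>b \<in> C\<close> by (subst card_Diff_subset) auto
  then obtain c where "C - {a,b} = {c}" using card_1_singletonE by blast
  ultimately have Ceq: "C = {a,b,c}" "c \<noteq> a" "c \<noteq> b" by blast+
  have "independent ((\<lambda>x. - a + x) ` (C - {a}))"
    using C(1) \<open>a \<in> C\<close> by (metis affine_dependent_iff_dependent2)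
  moreover have "(\<lambda>x. - a + x) ` (C - {a}) = {b - a, c - a}" using Ceq neq by auto
  ultimately have ind: "independent {b - a, c - a}" by simp
  have bc: "b - a \<noteq> c - a" using Ceq by simp
  have "span {b - a, c - a} = UNIV"
    using ind bc by (intro dim_eq_full[THEN iffD1]) (simp add: dim_eq_card_independent)
  obtain s :: "point \<Rightarrow> real" where s: "linear s" "s (b - a) = 1" "s (c - a) = 0"
    using linear_independent_extend[OF ind, of "\<lambda>x. if x = b - a then 1 else 0"] bc by auto
  obtain t :: "point \<Rightarrow> real" where t: "linear t" "t (b - a) = 0" "t (c - a) = 1"
    using linear_independent_extend[OF ind, of "\<lambda>x. if x = b - a then 0 else 1"] bc by auto
  have decomp: "y = s y *\<^sub>R (b - a) + t y *\<^sub>R (c - a)" for y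
  proof -
    have lin: "linear (\<lambda>y. s y *\<^sub>R (b - a) + t y *\<^sub>R (c - a))"
      using s(1) t(1) by (auto simp: linear_iff algebra_simps)
    have id: "linear (\<lambda>y::point. y)" by (simp add: linear_iff)
    have basis: "x = s x *\<^sub>R (b - a) + t x *\<^sub>R (c - a)" if "x \<in> {b - a, c - a}" for x
    proof -
      have "x = b - a \<or> x = c - a" using that by simp
      then show ?thesis by (rule disjE) (simp_all only: s t scaleR_one scaleR_zero_left add_0_left add_0_right)
    qed
    show ?thesis
      by (rule linear_eq_on[OF id lin _ basis])
        (simp_all only: \<open>span {b - a, c - a} = UNIV\<close> UNIV_I)
  qed
  have memK: "y \<in> K \<longleftrightarrow> 0 \<le> s (y - a) \<and> 0 \<le> t (y - a) \<and> s (y - a) + t (y - a) \<le> 1" for y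
  proof -
    have ex: "y \<in> K \<longleftrightarrow> (\<exists>u v. y = a + u *\<^sub>R (b - a) + v *\<^sub>R (c - a) \<and> 0 \<le> u \<and> 0 \<le> v \<and> u + v \<le> 1)"
      unfolding C(3) Ceq(1) convex_hull_3_alt by auto
    have uv: "s (y - a) = u \<and> t (y - a) = v" if "y = a + u *\<^sub>R (b - a) + v *\<^sub>R (c - a)" for u v
    proof -
      have "y - a = u *\<^sub>R (b - a) + v *\<^sub>R (c - a)" using that by simp
      then show ?thesis using s t by (simp add: linear_add linear_scale)
    qed
    have "y = a + s (y - a) *\<^sub>R (b - a) + t (y - a) *\<^sub>R (c - a)"
      using decomp[of "y - a"] by (simp add: algebra_simps)
    then show ?thesis unfolding ex by (metis uv)
  qed
  \<comment> \<open>The Riesz representative of \<open>t\<close> with reversed sign, so that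
    \<open>t \<ge> 0\<close> becomes the side where the product with \<open>m\<close> is at most 0:
    an outer normal of \<open>K\<close>, not normalised.\<close>
  define m where "m = - adjoint t 1"
  have tm: "t y = - (y \<bullet> m)" for y
    using adjoint_works[OF t(1), of y 1] by (simp add: m_def inner_commute)
  show ?thesis
  proof (rule that[of m])
    show "m \<noteq> 0" using tm[of "c - a"] t(3) by auto
    show "m \<bullet> (b - a) = 0" using tm[of "b - a"] t(2) by (simp add: inner_commute)
    fix x assume "x \<in> open_segment a b"
    then obtain u where u: "0 < u" "u < 1" "x = (1 - u) *\<^sub>R a + u *\<^sub>R b"
      using neq by (auto simp: in_segment)
    then have xa: "x - a = u *\<^sub>R (b - a)" by (simp add: algebra_simps)
    have sx: "s (x - a) = u" "t (x - a) = 0" using s t unfolding xa by (auto simp: linear_scale)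
    have cont: "continuous_on UNIV s" "continuous_on UNIV t"
      using s(1) t(1) by (auto simp: linear_continuous_on linear_conv_bounded_linear)
    have "open {y. 0 < s (y - a) \<and> s (y - a) + t (y - a) < 1}"
      by (intro open_Collect_conj open_Collect_less continuous_intros continuous_on_compose2[OF cont(1)]
          continuous_on_compose2[OF cont(2)]) auto
    moreover have "x \<in> {y. 0 < s (y - a) \<and> s (y - a) + t (y - a) < 1}" using sx u by simp
    ultimately obtain r where r: "r > 0" "ball x r \<subseteq> {y. 0 < s (y - a) \<and> s (y - a) + t (y - a) < 1}"
      using open_contains_ball by blast
    have "y \<in> K \<longleftrightarrow> (y - x) \<bullet> m \<le> 0" if "y \<in> ball x r" for y
    proof -
      have "t (y - a) = t (y - x) + t (x - a)" using t(1) by (simp add: linear_diff)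
      then have "t (y - a) = - ((y - x) \<bullet> m)" using sx tm by simp
      then show ?thesis using memK[of y] r(2) that by force
    qed
    then show "\<exists>r>0. K \<inter> ball x r = {y \<in> ball x r. (y - x) \<bullet> m \<le> 0}" using r(1) by blast
  qed
qed

lemma triangulated_bodyD:
  assumes "triangulated_body D"
  shows "lipschitz_domain (region D)" "triangulation (tris D)"
    "\<And>K. K \<in> tris D \<Longrightarrow> 2 simplex K" "\<Union>(tris D) = closure (region D)"
    "\<And>a b. (a, b) \<in> set (segs (chain D)) \<Longrightarrow> \<exists>K\<in>tris D. closed_segment a b edge_of K"
    "\<And>a b. (a, b) \<in> set (segs (chain D)) \<Longrightarrow> closed_segment a b \<subseteq> frontier (region D)"
    "interior (closure (region D)) = region D" "bounded (region D)" "open (region D)"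
  using assms interior_closure_lipschitz_domain
  unfolding triangulated_body_def lipschitz_domain_def by blast+

text \<open>Two triangles with a common edge lie on opposite sides of it and together cover a
  neighbourhood of each of its relative interior points, so the edge is not on the boundary.\<close>

lemma unique_triangle_at_boundary_edge:
  assumes D: "triangulated_body D" and ab: "(a, b) \<in> set (segs (chain D))"
    and K: "K \<in> tris D" "closed_segment a b edge_of K"
    and K': "K' \<in> tris D" and x: "x \<in> open_segment a b" "x \<in> K'"
  shows "K' = K"
proof (rule ccontr)
  assume neq: "K' \<noteq> K"
  note T = triangulated_bodyD(2)[OF D]
  have s: "2 simplex K" "2 simplex K'" using triangulated_bodyD(3)[OF D] K(1) K' by auto
  have anb: "a \<noteq> b" using x(1) by auto
  have fK: "closed_segment a b face_of K" using K(2) by (simp add: edge_of_def)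
  \<comment> \<open>\<open>K \<inter> K'\<close> is a face of \<open>K\<close> meeting the relative
    interior of the edge, and such a face contains the whole edge. So the triangles share the edge
    and not just a point.\<close>
  have "closed_segment a b \<subseteq> K \<inter> K'"
  proof (rule subset_of_face_of)
    show "(K \<inter> K') face_of K" by (rule triangulationD(5)[OF T K(1) K'])
    show sub: "closed_segment a b \<subseteq> K" using fK by (rule face_of_imp_subset)
    have "x \<in> rel_interior (closed_segment a b)" using x(1) anb by (simp add: rel_interior_closed_segment)
    moreover have "x \<in> K" using sub x(1) open_closed_segment by blast
    ultimately show "K \<inter> K' \<inter> rel_interior (closed_segment a b) \<noteq> {}" using x(2) by blast
  qed
  then have "closed_segment a b face_of K \<inter> K'"
    using fK by (meson face_of_subset inf_le1)
  then have "closed_segment a b face_of K'"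
    using triangulationD(6)[OF T K(1) K'] face_of_trans by blast
  then have e': "closed_segment a b edge_of K'" using K(2) by (simp add: edge_of_def)
  \<comment> \<open>Distinct triangles meet in a proper face of at least one of them, which has
    dimension below two.\<close>
  have "K \<inter> K' \<noteq> K \<or> K \<inter> K' \<noteq> K'" using neq by blast
  then have "aff_dim (K \<inter> K') < 2"
    using face_of_aff_dim_lt[OF convex_simplex[OF s(1)] triangulationD(5)[OF T K(1) K']]
      face_of_aff_dim_lt[OF convex_simplex[OF s(2)] triangulationD(6)[OF T K(1) K']]
      aff_dim_simplex[OF s(1)] aff_dim_simplex[OF s(2)] by auto
  then have empty: "interior (K \<inter> K') = {}" using aff_dim_nonempty_interior[of "K \<inter> K'"] by force
  obtain m where m: "m \<noteq> 0" "m \<bullet> (b - a) = 0"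
    "\<And>x. x \<in> open_segment a b \<Longrightarrow> \<exists>r>0. K \<inter> ball x r = {y \<in> ball x r. (y - x) \<bullet> m \<le> 0}"
    using simplex_half_disc[OF s(1) K(2)] by blast
  obtain m' where m': "m' \<noteq> 0" "m' \<bullet> (b - a) = 0"
    "\<And>x. x \<in> open_segment a b \<Longrightarrow> \<exists>r>0. K' \<inter> ball x r = {y \<in> ball x r. (y - x) \<bullet> m' \<le> 0}"
    using simplex_half_disc[OF s(2) e'] by blast
  obtain k where k: "m' = k *\<^sub>R m" using parallel_plane[of "b - a" m m'] m m' anb by auto
  obtain r r' where r: "r > 0" "K \<inter> ball x r = {y \<in> ball x r. (y - x) \<bullet> m \<le> 0}"
    and r': "r' > 0" "K' \<inter> ball x r' = {y \<in> ball x r'. (y - x) \<bullet> m' \<le> 0}"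
    using m(3)[OF x(1)] m'(3)[OF x(1)] by blast
  define \<rho> where "\<rho> = min r r'"
  have \<rho>: "\<rho> > 0" "ball x \<rho> \<subseteq> ball x r" "ball x \<rho> \<subseteq> ball x r'" using r r' by (auto simp: \<rho>_def)
  have iK: "y \<in> K \<longleftrightarrow> (y - x) \<bullet> m \<le> 0" "y \<in> K' \<longleftrightarrow> k * ((y - x) \<bullet> m) \<le> 0" if "y \<in> ball x \<rho>" for y
  proof -
    have "y \<in> ball x r" "y \<in> ball x r'" using that \<rho> by blast+
    then have "y \<in> K \<longleftrightarrow> (y - x) \<bullet> m \<le> 0" "y \<in> K' \<longleftrightarrow> (y - x) \<bullet> m' \<le> 0"
      using r(2) r'(2) by blast+
    then show "y \<in> K \<longleftrightarrow> (y - x) \<bullet> m \<le> 0" "y \<in> K' \<longleftrightarrow> k * ((y - x) \<bullet> m) \<le> 0" by (simp_all add: k)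
  qed
  have "k \<noteq> 0" using k m' by auto
  then consider "k > 0" | "k < 0" by linarith
  then show False
  proof cases
    case 1
    \<comment> \<open>Equally directed normals would make both triangles contain an open half disc;
      \<open>y\<close>, at distance \<open>\<rho> / 2\<close> from \<open>x\<close>, shows that it
      is nonempty.\<close>
    define y where "y = x - (\<rho> / (2 * norm m)) *\<^sub>R m"
    let ?U = "ball x \<rho> \<inter> {y. (y - x) \<bullet> m < 0}"
    have "open ?U" by (intro open_Int open_ball open_Collect_less continuous_intros)
    moreover have "?U \<subseteq> K \<inter> K'" using iK 1 by (auto simp: mult_le_0_iff)
    moreover have "y \<in> ?U" using \<rho>(1) m(1) by (auto simp: y_def dist_norm)
    ultimately show False using empty interior_maximal by blast
  next
    case 2
    have "ball x \<rho> \<subseteq> K \<union> K'" using iK 2 by (auto simp: mult_le_0_iff)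
    also have "\<dots> \<subseteq> closure (region D)" using triangulated_bodyD(4)[OF D] K K' by blast
    finally have "x \<in> interior (closure (region D))" using \<rho>(1) mem_interior by blast
    then have "x \<in> region D" using triangulated_bodyD(7)[OF D] by simp
    moreover have "x \<in> frontier (region D)"
      using triangulated_bodyD(6)[OF D ab] x(1) open_closed_segment by blast
    ultimately show False using triangulated_bodyD(9)[OF D] by (simp add: frontier_def interior_open)
  qed
qed

text \<open>The other triangles form a closed set missing \<open>x\<close>, so near \<open>x\<close>
  the closed domain is \<open>K\<close>, a closed half disc. Taking interiors gives back the domain
  and makes the inequality strict.\<close>

lemma region_half_disc_at_interface:
  assumes D: "triangulated_body D" and ab: "(a, b) \<in> set (segs (chain D))"
  shows "\<exists>m. \<forall>x\<in>open_segment a b. \<exists>r>0. region D \<inter> ball x r = {y \<in> ball x r. (y - x) \<bullet> m < 0}"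
proof -
  obtain K where K: "K \<in> tris D" "closed_segment a b edge_of K"
    using triangulated_bodyD(5)[OF D ab] by blast
  have s: "2 simplex K" using triangulated_bodyD(3)[OF D] K(1) by auto
  note T = triangulated_bodyD(2)[OF D]
  obtain m where m: "m \<noteq> 0" "m \<bullet> (b - a) = 0"
    "\<And>x. x \<in> open_segment a b \<Longrightarrow> \<exists>r>0. K \<inter> ball x r = {y \<in> ball x r. (y - x) \<bullet> m \<le> 0}"
    using simplex_half_disc[OF s K(2)] by blast
  show ?thesis
  proof (intro exI[of _ m] ballI)
    fix x assume x: "x \<in> open_segment a b"
    obtain r where r: "r > 0" "K \<inter> ball x r = {y \<in> ball x r. (y - x) \<bullet> m \<le> 0}" using m(3)[OF x] by blast
    have "closed (\<Union>(tris D - {K}))"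
      using triangulationD(1,3)[OF T] by (intro closed_Union) (auto intro: compact_imp_closed)
    moreover have "x \<notin> \<Union>(tris D - {K})" using unique_triangle_at_boundary_edge[OF D ab K _ x] by blast
    ultimately obtain e where e: "e > 0" "ball x e \<inter> \<Union>(tris D - {K}) = {}"
      using open_contains_ball[of "- \<Union>(tris D - {K})"] by (metis ComplI disjoint_eq_subset_Compl open_Compl)
    define \<rho> where "\<rho> = min r e"
    have \<rho>: "\<rho> > 0" "ball x \<rho> \<subseteq> ball x r" "ball x \<rho> \<subseteq> ball x e" using r e by (auto simp: \<rho>_def)
    have cl: "closure (region D) \<inter> ball x \<rho> = {y. m \<bullet> y \<le> m \<bullet> x} \<inter> ball x \<rho>"
    proof -
      have "closure (region D) \<inter> ball x \<rho> = K \<inter> ball x \<rho>"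
        unfolding triangulated_bodyD(4)[OF D, symmetric] using K(1) e(2) \<rho>(3) by blast
      also have "\<dots> = {y. m \<bullet> y \<le> m \<bullet> x} \<inter> ball x \<rho>"
      proof -
        have "y \<in> K \<longleftrightarrow> (y - x) \<bullet> m \<le> 0" if "y \<in> ball x \<rho>" for y
          using r(2) subsetD[OF \<rho>(2) that] by blast
        then show ?thesis by (auto simp: inner_diff_left inner_commute[of m])
      qed
      finally show ?thesis .
    qed
    have "region D \<inter> ball x \<rho> = interior (closure (region D) \<inter> ball x \<rho>)"
      by (simp add: interior_Int triangulated_bodyD(7)[OF D] interior_open)
    also have "\<dots> = {y. m \<bullet> y < m \<bullet> x} \<inter> ball x \<rho>"
      unfolding cl by (simp add: interior_Int interior_open interior_halfspace_le m(1))
    also have "\<dots> = {y \<in> ball x \<rho>. (y - x) \<bullet> m < 0}" by (auto simp: inner_diff_left inner_commute[of m])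
    finally show "\<exists>r>0. region D \<inter> ball x r = {y \<in> ball x r. (y - x) \<bullet> m < 0}"
      using \<rho>(1) by blast
  qed
qed

text \<open>Translated to the origin, the condition on \<open>n\<close> depends on \<open>x\<close>
  only through the half plane of \<open>m\<close>, which is the same along the edge. The
  descriptions thus have one common value, and this is all that boundedness and measurability of the
  normal ask for.\<close>

lemma outward_normal_constant_on_edges:
  assumes D: "triangulated_body D" and ab: "(a, b) \<in> set (segs (chain D))"
  shows "\<exists>c. \<forall>x\<in>open_segment a b. outward_normal (region D) x = c"
proof -
  obtain m where m:
    "\<And>x. x \<in> open_segment a b \<Longrightarrow> \<exists>r>0. region D \<inter> ball x r = {y \<in> ball x r. (y - x) \<bullet> m < 0}"
    using region_half_disc_at_interface[OF D ab] by blast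
  let ?P = "\<lambda>n. norm n = 1 \<and> (\<exists>r>0. \<forall>h\<in>ball 0 r. h \<bullet> m < 0 \<longleftrightarrow> h \<bullet> n < 0)"
  have "outward_normal (region D) x = (THE n. ?P n)" if x: "x \<in> open_segment a b" for x
  proof -
    obtain r where r: "r > 0" "region D \<inter> ball x r = {y \<in> ball x r. (y - x) \<bullet> m < 0}"
      using m[OF x] by blast
    have "(\<exists>r>0. region D \<inter> ball x r = {y \<in> ball x r. (y - x) \<bullet> n < 0}) \<longleftrightarrow>
        (\<exists>r>0. \<forall>h\<in>ball 0 r. h \<bullet> m < 0 \<longleftrightarrow> h \<bullet> n < 0)" (is "?A \<longleftrightarrow> ?B") for n
    proof
      assume ?A
      then obtain r' where r': "r' > 0" "region D \<inter> ball x r' = {y \<in> ball x r'. (y - x) \<bullet> n < 0}" by blast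
      have "h \<bullet> m < 0 \<longleftrightarrow> h \<bullet> n < 0" if "h \<in> ball 0 (min r r')" for h
      proof -
        have "x + h \<in> ball x r" "x + h \<in> ball x r'" using that by (auto simp: dist_norm)
        then have "x + h \<in> region D \<longleftrightarrow> (x + h - x) \<bullet> m < 0" "x + h \<in> region D \<longleftrightarrow> (x + h - x) \<bullet> n < 0"
          using r(2) r'(2) by blast+
        then show ?thesis by simp
      qed
      then show ?B using r(1) r'(1) min_less_iff_conj[of 0 r r'] by blast
    next
      assume ?B
      then obtain s where s: "s > 0" "\<And>h. h \<in> ball 0 s \<Longrightarrow> h \<bullet> m < 0 \<longleftrightarrow> h \<bullet> n < 0" by blast
      have "y \<in> region D \<longleftrightarrow> (y - x) \<bullet> n < 0" if "y \<in> ball x (min r s)" for y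
      proof -
        have "y \<in> ball x r" "y - x \<in> ball 0 s" using that by (auto simp: dist_norm norm_minus_commute)
        moreover from this have "y \<in> region D \<longleftrightarrow> (y - x) \<bullet> m < 0" using r(2) by blast
        ultimately show ?thesis using s(2)[of "y - x"] by blast
      qed
      then have "region D \<inter> ball x (min r s) = {y \<in> ball x (min r s). (y - x) \<bullet> n < 0}" by blast
      then show ?A using r(1) s(1) min_less_iff_conj[of 0 r s] by blast
    qed
    then show ?thesis by (simp add: outward_normal_def)
  qed
  then show ?thesis by blast
qed

section \<open>The interface as a union of open edges and nodes\<close>

lemma closed_segment_subset_interface:
  "(a, b) \<in> set (segs (chain D)) \<Longrightarrow> closed_segment a b \<subseteq> interface D"
  unfolding interface_def by auto

lemma interface_point_on_edge:
  assumes "x \<in> interface D"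
  obtains a b where "(a, b) \<in> set (segs (chain D))" "x \<in> closed_segment a b"
  using assms unfolding interface_def by auto

lemma adjacent_choice_constant_on_edges:
  assumes D: "triangulated_body D" and \<tau>: "adjacent_choice D \<tau>" and ab: "(a, b) \<in> set (segs (chain D))"
  shows "\<exists>K. closed_segment a b edge_of K \<and> K \<in> tris D \<and> (\<forall>x\<in>open_segment a b. \<tau> x = K)"
proof -
  obtain K where K: "K \<in> tris D" "closed_segment a b edge_of K"
    using triangulated_bodyD(5)[OF D ab] by blast
  have "\<tau> x = K" if "x \<in> open_segment a b" for x
  proof -
    have "x \<in> interface D" 
      using closed_segment_subset_interface[OF ab] that open_closed_segment by blast
    then show ?thesis
      using unique_triangle_at_boundary_edge[OF D ab K _ that] \<tau> unfolding adjacent_choice_def by blast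
  qed
  then show ?thesis using K by blast
qed

text \<open>\<open>recovered_jacobian\<close> is known to be affine only on members of
  \<open>interface_tris\<close>, so its derivative within \<open>\<tau> x\<close> is under control
  once \<open>\<tau> x\<close> belongs there. Inside an edge the triangle contains an end node; at
  an end of an edge \<open>x\<close> itself is the required node.\<close>

lemma adjacent_choice_interface_tris:
  assumes D: "triangulated_body D" and \<tau>: "adjacent_choice D \<tau>" and x: "x \<in> interface D"
  shows "\<tau> x \<in> interface_tris D"
proof -
  obtain a b where ab: "(a, b) \<in> set (segs (chain D))" "x \<in> closed_segment a b"
    using x by (rule interface_point_on_edge)
  obtain K where K: "closed_segment a b edge_of K" "K \<in> tris D" "\<forall>x\<in>open_segment a b. \<tau> x = K"
    using adjacent_choice_constant_on_edges[OF D \<tau> ab(1)] by blast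
  have face: "closed_segment a b face_of K" using K by (simp add: edge_of_def)
  then have "a extreme_point_of K" "b extreme_point_of K"
    using extreme_point_of_face[OF face] extreme_point_of_segment by blast+
  then have nodes: "a \<in> nodes (tris D)" "b \<in> nodes (tris D)" "a \<in> K"
    using K by (auto simp: nodes_def extreme_point_of_def)
  have "a \<in> interface D" "b \<in> interface D" 
    using closed_segment_subset_interface[OF ab(1)] by auto
  then have "\<exists>z\<in>nodes (tris D) \<inter> interface D. z \<in> \<tau> x"
  proof (cases "x \<in> open_segment a b")
    case True
    then show ?thesis using K nodes \<open>a \<in> interface D\<close> by auto
  next
    case False
    then have "x = a \<or> x = b" using ab(2) by (auto simp: open_segment_def)
    then show ?thesis
      using nodes \<open>a \<in> interface D\<close> \<open>b \<in> interface D\<close> \<tau> unfolding adjacent_choice_def by blast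
  qed
  then show ?thesis using \<tau> x unfolding interface_tris_def adjacent_choice_def by blast
qed

text \<open>Finitely many pieces on which normals and one-sided gradients are constant. The nodes
  are kept as pieces of their own, since a map into the interface may hit them with positive
  measure.\<close>

lemma interface_eq_Union_edges:
  "interface D = \<Union>((\<lambda>(a, b). open_segment a b) ` set (segs (chain D)) \<union>
     (\<lambda>z. {z}) ` (fst ` set (segs (chain D)) \<union> snd ` set (segs (chain D))))"
  (is "_ = \<Union>(?E \<union> ?N)")
proof
  show "interface D \<subseteq> \<Union>(?E \<union> ?N)"
  proof
    fix x assume "x \<in> interface D"
    then obtain a b where ab: "(a, b) \<in> set (segs (chain D))" "x \<in> closed_segment a b"
      by (rule interface_point_on_edge)
    then have "open_segment a b \<in> ?E" "{a} \<in> ?N" "{b} \<in> ?N" by force+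
    moreover have "x \<in> open_segment a b \<or> x \<in> {a} \<or> x \<in> {b}"
      using ab(2) by (auto simp: open_segment_def)
    ultimately show "x \<in> \<Union>(?E \<union> ?N)" by (meson UnI1 UnI2 UnionI)
  qed
  have "open_segment a b \<subseteq> interface D \<and> a \<in> interface D \<and> b \<in> interface D"
    if "(a, b) \<in> set (segs (chain D))" for a b
    using closed_segment_subset_interface[OF that] segment_open_subset_closed[of a b] by auto
  then show "\<Union>(?E \<union> ?N) \<subseteq> interface D" by auto
qed

lemma compact_interface: "compact (interface D)"
  unfolding interface_def by (intro compact_UN) auto

lemma interface_subset_closure: "triangulated_body D \<Longrightarrow> interface D \<subseteq> closure (region D)"
  using triangulated_bodyD(6) by (auto simp: frontier_def elim!: interface_point_on_edge)

lemma triangulation_interface_tris: "triangulated_body D \<Longrightarrow> triangulation (interface_tris D)"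
  by (drule triangulated_bodyD(2)) (auto simp: triangulation_def interface_tris_def)

section \<open>Essentially bounded functions and the arc-length measure\<close>

text \<open>A condition at every point of \<open>\<Gamma>\<close>, not almost everywhere. The
  indicator turns measurability on \<open>\<Gamma>\<close> into Borel measurability on the plane,
  which survives composition with a measurable map.\<close>

definition piecewise_bounded :: "point set \<Rightarrow> (point \<Rightarrow> 'b::euclidean_space) \<Rightarrow> bool" where
  "piecewise_bounded \<Gamma> H \<longleftrightarrow>
     (\<lambda>y. indicat_real \<Gamma> y *\<^sub>R H y) \<in> borel_measurable borel \<and> bounded (H ` \<Gamma>)"

definition ess_bounded :: "point measure \<Rightarrow> (point \<Rightarrow> 'b::euclidean_space) \<Rightarrow> bool" where
  "ess_bounded M f \<longleftrightarrow> f \<in> borel_measurable M \<and> (\<exists>B. AE x in M. norm (f x) \<le> B)"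

lemma borel_measurable_AE_cong:
  fixes f g :: "'a \<Rightarrow> 'b::topological_space"
  assumes M: "complete_measure M" and f: "f \<in> borel_measurable M" and eq: "AE x in M. f x = g x"
  shows "g \<in> borel_measurable M"
proof (rule measurableI)
  fix A :: "'b set" assume A: "A \<in> sets borel"
  show "g -` A \<inter> space M \<in> sets M"
  proof (rule complete_measure.in_sets_AE[OF M])
    show "AE x in M. (x \<in> f -` A \<inter> space M) = (x \<in> g -` A \<inter> space M)"
      using eq by eventually_elim auto
    show "f -` A \<inter> space M \<in> sets M" using f A by (rule measurable_sets)
  qed auto
qed auto

lemma ess_bounded_AE_cong:
  assumes "complete_measure M" "ess_bounded M f" "AE x in M. f x = g x"
  shows "ess_bounded M g"
proof -
  obtain B where "AE x in M. norm (f x) \<le> B" using assms(2) unfolding ess_bounded_def by blast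
  then have "AE x in M. norm (g x) \<le> B" using assms(3) by eventually_elim simp
  moreover have "g \<in> borel_measurable M"
    using borel_measurable_AE_cong[OF assms(1) _ assms(3)] assms(2) unfolding ess_bounded_def by blast
  ultimately show ?thesis unfolding ess_bounded_def by blast
qed

lemma ess_bounded_integrable: "finite_measure M \<Longrightarrow> ess_bounded M f \<Longrightarrow> integrable M f"
  unfolding ess_bounded_def using finite_measure.integrable_const_bound by blast

lemma ess_bounded_add:
  assumes "ess_bounded M f" "ess_bounded M g" shows "ess_bounded M (\<lambda>x. f x + g x)"
proof -
  obtain B C where "AE x in M. norm (f x) \<le> B" "AE x in M. norm (g x) \<le> C"
    using assms unfolding ess_bounded_def by blast
  then have "AE x in M. norm (f x + g x) \<le> B + C" by eventually_elim (rule norm_triangle_mono)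
  then show ?thesis using assms unfolding ess_bounded_def by auto
qed

lemma ess_bounded_linear:
  assumes "linear T" "ess_bounded M f" shows "ess_bounded M (\<lambda>x. T (f x))"
proof -
  have T: "bounded_linear T" using assms(1) by (simp add: linear_conv_bounded_linear)
  obtain B where B: "AE x in M. norm (f x) \<le> B" using assms unfolding ess_bounded_def by blast
  have "AE x in M. norm (T (f x)) \<le> onorm T * B"
    using B
  proof eventually_elim
    case (elim x)
    have "norm (T (f x)) \<le> onorm T * norm (f x)" using T by (rule onorm)
    also have "\<dots> \<le> onorm T * B" using elim onorm_pos_le[OF T] by (rule mult_left_mono)
    finally show ?case .
  qed
  moreover have "(\<lambda>x. T (f x)) \<in> borel_measurable M"
    using assms(2) borel_measurable_continuous_onI[OF linear_continuous_on[OF T]]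
    unfolding ess_bounded_def by auto
  ultimately show ?thesis unfolding ess_bounded_def by blast
qed

lemma ess_bounded_bilinear:
  assumes h: "bounded_bilinear h" and "ess_bounded M f" "ess_bounded M g"
  shows "ess_bounded M (\<lambda>x. h (f x) (g x))"
proof -
  obtain B C where BC: "AE x in M. norm (f x) \<le> B" "AE x in M. norm (g x) \<le> C"
    using assms unfolding ess_bounded_def by blast
  obtain K where K: "K > 0" "\<And>a b. norm (h a b) \<le> norm a * norm b * K"
    using bounded_bilinear.pos_bounded[OF h] by blast
  have "AE x in M. norm (h (f x) (g x)) \<le> B * C * K"
    using BC
  proof eventually_elim
    case (elim x)
    have "norm (h (f x) (g x)) \<le> norm (f x) * norm (g x) * K" by (rule K)
    also have "\<dots> \<le> B * C * K"
      using elim K(1) by (intro mult_right_mono mult_mono order_trans[OF norm_ge_zero elim(1)]) auto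
    finally show ?case .
  qed
  moreover have "(\<lambda>x. h (f x) (g x)) \<in> borel_measurable M"
  proof (rule borel_measurable_continuous_Pair[where H = h])
    show "continuous_on UNIV (\<lambda>x. h (fst x) (snd x))"
      by (intro bounded_bilinear.continuous_on[OF h] continuous_intros)
  qed (use assms in \<open>auto simp: ess_bounded_def\<close>)
  ultimately show ?thesis unfolding ess_bounded_def by blast
qed

lemma ess_bounded_vec_lambda:
  fixes f :: "'n::finite \<Rightarrow> point \<Rightarrow> 'b::euclidean_space"
  assumes "\<And>i. ess_bounded M (f i)" shows "ess_bounded M (\<lambda>x. \<chi> i. f i x)"
proof -
  have "\<forall>i. \<exists>B. AE x in M. norm (f i x) \<le> B" using assms unfolding ess_bounded_def by blast
  then obtain B where "\<And>i. AE x in M. norm (f i x) \<le> B i" by metis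
  then have "AE x in M. \<forall>i. norm (f i x) \<le> B i" by (simp add: AE_all_countable)
  then have "AE x in M. norm (\<chi> i. f i x) \<le> (\<Sum>i\<in>UNIV. B i)"
  proof eventually_elim
    case (elim x)
    have "norm (\<chi> i. f i x) \<le> (\<Sum>i\<in>UNIV. norm (f i x))"
      using L2_set_le_sum[of UNIV "\<lambda>i. norm (f i x)"] by (simp add: norm_vec_def)
    also have "\<dots> \<le> (\<Sum>i\<in>UNIV. B i)" using elim by (intro sum_mono) auto
    finally show ?case .
  qed
  moreover have "f i \<in> borel_measurable M" for i using assms unfolding ess_bounded_def by blast
  then have "(\<lambda>x. \<chi> i. f i x) \<in> borel_measurable M"
    by (subst borel_measurable_euclidean_space) (auto simp: Basis_vec_def inner_axis)
  ultimately show ?thesis unfolding ess_bounded_def by blast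
qed

lemma piecewise_bounded_continuous:
  assumes "compact \<Gamma>" "continuous_on \<Gamma> H" shows "piecewise_bounded \<Gamma> H"
  unfolding piecewise_bounded_def
  using assms borel_measurable_continuous_on_indicator[of \<Gamma> H]
  by (simp add: borel_closed compact_imp_closed compact_imp_bounded compact_continuous_image)

text \<open>The pieces may overlap: the preimage of \<open>B\<close> is the union of those whose
  value lies in \<open>B\<close>, together with the complement of them all when \<open>B\<close>
  contains 0, the value that the indicator produces there.\<close>

lemma piecewise_bounded_const_on_pieces:
  fixes H :: "point \<Rightarrow> 'b::euclidean_space"
  assumes A: "finite \<A>" "\<A> \<subseteq> sets borel" and c: "\<And>A. A \<in> \<A> \<Longrightarrow> \<exists>c. \<forall>x\<in>A. H x = c"
  shows "piecewise_bounded (\<Union>\<A>) H"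
  unfolding piecewise_bounded_def
proof
  obtain c where c: "\<And>A x. A \<in> \<A> \<Longrightarrow> x \<in> A \<Longrightarrow> H x = c A" using c by metis
  show "(\<lambda>y. indicat_real (\<Union>\<A>) y *\<^sub>R H y) \<in> borel_measurable borel"
  proof (rule measurableI)
    fix B :: "'b set"
    have U: "\<Union>\<A> \<in> sets borel" using A by (intro sets.finite_Union) auto
    have "(\<lambda>y. indicat_real (\<Union>\<A>) y *\<^sub>R H y) -` B \<inter> space borel =
        \<Union>{A \<in> \<A>. c A \<in> B} \<union> (if 0 \<in> B then - \<Union>\<A> else {})" (is "?L = ?R")
    proof (intro set_eqI)
      fix y
      show "y \<in> ?L \<longleftrightarrow> y \<in> ?R"
      proof (cases "y \<in> \<Union>\<A>")
        case True
        then obtain A where "A \<in> \<A>" "y \<in> A" by blast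
        then have "y \<in> \<Union>{A \<in> \<A>. c A \<in> B} \<longleftrightarrow> H y \<in> B" using c by fastforce
        then show ?thesis using True by auto
      next
        case False
        then show ?thesis by auto
      qed
    qed
    moreover have "\<Union>{A \<in> \<A>. c A \<in> B} \<in> sets borel" using A by (intro sets.finite_Union) auto
    moreover have "- \<Union>\<A> \<in> sets borel" using U by (rule borel_comp)
    ultimately show "(\<lambda>y. indicat_real (\<Union>\<A>) y *\<^sub>R H y) -` B \<inter> space borel \<in> sets borel" by simp
  qed simp
  have "H ` \<Union>\<A> \<subseteq> c ` \<A>" using c by auto
  then show "bounded (H ` \<Union>\<A>)"
    by (rule finite_imp_bounded[OF finite_subset]) (simp add: A(1))
qed

text \<open>Together with its indicator \<open>H\<close> is Borel on the plane, so the composition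
  is measurable. Along \<open>\<phi>\<close> the indicator is 1 almost everywhere, and completeness
  of \<open>M\<close> allows it to be dropped.\<close>

lemma piecewise_bounded_compose:
  assumes M: "complete_measure M" and H: "piecewise_bounded \<Gamma> H"
    and \<phi>: "\<phi> \<in> borel_measurable M" "AE x in M. \<phi> x \<in> \<Gamma>"
  shows "ess_bounded M (\<lambda>x. H (\<phi> x))"
proof (rule ess_bounded_AE_cong[OF M])
  obtain B where B: "\<And>y. y \<in> \<Gamma> \<Longrightarrow> norm (H y) \<le> B" using H unfolding piecewise_bounded_def bounded_iff by auto
  have "AE x in M. norm (indicat_real \<Gamma> (\<phi> x) *\<^sub>R H (\<phi> x)) \<le> B"
    using \<phi>(2) by eventually_elim (simp add: B)
  moreover have "(\<lambda>x. indicat_real \<Gamma> (\<phi> x) *\<^sub>R H (\<phi> x)) \<in> borel_measurable M"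
    using H measurable_compose[OF \<phi>(1)] unfolding piecewise_bounded_def by blast
  ultimately show "ess_bounded M (\<lambda>x. indicat_real \<Gamma> (\<phi> x) *\<^sub>R H (\<phi> x))"
    unfolding ess_bounded_def by blast
  show "AE x in M. indicat_real \<Gamma> (\<phi> x) *\<^sub>R H (\<phi> x) = H (\<phi> x)"
    using \<phi>(2) by eventually_elim simp
qed

section \<open>Arc length on the polygonal chain\<close>

definition chain_content :: "point list \<Rightarrow> point measure" where
  "chain_content zs = measure_of UNIV (sets borel)
     (\<lambda>A. \<Sum>(a, b)\<leftarrow>segs zs. emeasure (segment_length_measure a b) A)"

lemma arclength_eq: "arclength zs = completion (chain_content zs)"
  by (simp add: arclength_def chain_content_def)

lemma complete_arclength: "complete_measure (arclength zs)"
  unfolding arclength_eq by (rule completion.complete_measure_axioms)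

lemma sets_chain_content [simp]: "sets (chain_content zs) = sets borel"
  unfolding chain_content_def using sets.sigma_sets_eq[of "borel :: point measure"] by simp

lemma space_chain_content [simp]: "space (chain_content zs) = UNIV"
  unfolding chain_content_def by simp

text \<open>\<open>measure_of\<close> gives the zero measure when its set function is not a measure.
  The inequality holds in either case, and an upper bound suffices both for finiteness and for the
  null set off the interface.\<close>

lemma emeasure_chain_content_le:
  "emeasure (chain_content zs) A \<le> (\<Sum>(a, b)\<leftarrow>segs zs. emeasure (segment_length_measure a b) A)"
  unfolding chain_content_def by (subst emeasure_measure_of_conv) auto

lemma emeasure_segment_length_measure:
  assumes "A \<in> sets borel"
  shows "emeasure (segment_length_measure a b) A =
    ennreal (dist a b) * emeasure (lebesgue_on {0..1}) (linepath a b -` A \<inter> {0..1})"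
proof -
  have "linepath a b \<in> measurable (lebesgue_on {0..1}) borel"
    by (intro continuous_imp_measurable_on_sets_lebesgue continuous_intros) auto
  then show ?thesis
    unfolding segment_length_measure_def using assms by (simp add: emeasure_distr)
qed

lemma finite_measure_arclength: "finite_measure (arclength zs)"
proof
  have "emeasure (segment_length_measure a b) UNIV < \<infinity>" for a b
    by (subst emeasure_segment_length_measure)
      (auto simp: emeasure_restrict_space ennreal_mult_less_top)
  then have "(\<Sum>(a, b)\<leftarrow>ps. emeasure (segment_length_measure a b) UNIV) < \<infinity>" for ps
    by (induction ps) auto
  then have "emeasure (chain_content zs) UNIV < \<infinity>"
    using emeasure_chain_content_le order.strict_trans1 by blast
  then show "emeasure (arclength zs) (space (arclength zs)) \<noteq> \<infinity>"
    unfolding arclength_eq by simp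
qed

lemma AE_interface_measure: "AE x in interface_measure D. x \<in> interface D"
proof -
  have borel: "- interface D \<in> sets borel"
    using compact_interface[of D] by (intro borel_comp borel_closed compact_imp_closed)
  have "emeasure (segment_length_measure a b) (- interface D) = 0" if "(a, b) \<in> set (segs (chain D))" for a b
  proof -
    have "linepath a b -` (- interface D) \<inter> {0..1} = {}"
      using closed_segment_subset_interface[OF that] linepath_in_path[of _ a b] by blast
    then show ?thesis using borel by (subst emeasure_segment_length_measure) auto
  qed
  then have "(\<Sum>(a, b)\<leftarrow>segs (chain D). emeasure (segment_length_measure a b) (- interface D)) = 0"
    by (auto simp: sum_list_eq_0_iff split: prod.split)
  then have "emeasure (chain_content (chain D)) (- interface D) = 0"
    using emeasure_chain_content_le[of "chain D" "- interface D"] by (metis le_zero_eq)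
  then have "- interface D \<in> null_sets (chain_content (chain D))" using borel by (auto intro: null_setsI)
  then have "AE x in chain_content (chain D). x \<notin> - interface D" by (rule AE_not_in)
  then show ?thesis unfolding arclength_eq by (auto intro: AE_completion)
qed

lemma space_arclength [simp]: "space (arclength zs) = UNIV"
  by (simp add: arclength_eq)

lemma borel_subset_sets_arclength: "sets borel \<subseteq> sets (arclength zs)"
  by (auto simp: arclength_eq)

lemma id_measurable_arclength: "(\<lambda>x. x) \<in> borel_measurable (arclength zs)"
  by (rule measurableI) (use borel_subset_sets_arclength in auto)

lemma ess_bounded_interface:
  "piecewise_bounded (interface D) H \<Longrightarrow> ess_bounded (interface_measure D) H"
  using piecewise_bounded_compose[OF complete_arclength _ id_measurable_arclength AE_interface_measure] .

text \<open>A node is a one-point piece, so any value is allowed there: whichever triangle or normal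
  is selected at a corner is harmless.\<close>

lemma piecewise_bounded_edges:
  assumes "\<And>a b. (a, b) \<in> set (segs (chain D)) \<Longrightarrow> \<exists>c. \<forall>x\<in>open_segment a b. H x = c"
  shows "piecewise_bounded (interface D) H"
  unfolding interface_eq_Union_edges
proof (rule piecewise_bounded_const_on_pieces)
  have "open_segment a b \<in> sets borel" for a b :: point
    unfolding open_segment_def by (intro sets.Diff borel_closed) auto
  then show "(\<lambda>(a, b). open_segment a b) ` set (segs (chain D)) \<union>
     (\<lambda>z. {z}) ` (fst ` set (segs (chain D)) \<union> snd ` set (segs (chain D))) \<subseteq> sets borel" by auto
  fix A assume "A \<in> (\<lambda>(a, b). open_segment a b) ` set (segs (chain D)) \<union>
     (\<lambda>z. {z}) ` (fst ` set (segs (chain D)) \<union> snd ` set (segs (chain D)))"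
  then show "\<exists>c. \<forall>x\<in>A. H x = c" using assms by auto
qed auto

section \<open>Linearity of the gradient recovery\<close>

lemma quadratics_add:
  assumes "p \<in> quadratics" "q \<in> quadratics" shows "(\<lambda>x. p x + q x) \<in> quadratics"
proof -
  obtain a b c d e f where p: "\<And>x. p x = a + b * x$1 + c * x$2 + d * (x$1)\<^sup>2 + e * (x$1 * x$2) + f * (x$2)\<^sup>2"
    using assms(1) unfolding quadratics_def by blast
  obtain a' b' c' d' e' f' where q: "\<And>x. q x = a' + b' * x$1 + c' * x$2 + d' * (x$1)\<^sup>2 + e' * (x$1 * x$2) + f' * (x$2)\<^sup>2"
    using assms(2) unfolding quadratics_def by blast
  show ?thesis unfolding quadratics_def mem_Collect_eq
    by (rule exI[of _ "a + a'"], rule exI[of _ "b + b'"], rule exI[of _ "c + c'"], rule exI[of _ "d + d'"],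
        rule exI[of _ "e + e'"], rule exI[of _ "f + f'"]) (simp add: p q distrib_right)
qed

lemma quadratics_mult:
  assumes "p \<in> quadratics" shows "(\<lambda>x. r * p x) \<in> quadratics"
proof -
  obtain a b c d e f where p: "\<And>x. p x = a + b * x$1 + c * x$2 + d * (x$1)\<^sup>2 + e * (x$1 * x$2) + f * (x$2)\<^sup>2"
    using assms(1) unfolding quadratics_def by blast
  show ?thesis unfolding quadratics_def mem_Collect_eq
    by (rule exI[of _ "r * a"], rule exI[of _ "r * b"], rule exI[of _ "r * c"], rule exI[of _ "r * d"],
        rule exI[of _ "r * e"], rule exI[of _ "r * f"]) (simp add: p distrib_left)
qed

lemma quadratics_differentiable:
  assumes "p \<in> quadratics" shows "p differentiable (at z)"
proof -
  obtain a b c d e f where p: "\<And>x. p x = a + b * x$1 + c * x$2 + d * (x$1)\<^sup>2 + e * (x$1 * x$2) + f * (x$2)\<^sup>2"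
    using assms(1) unfolding quadratics_def by blast
  have nth: "(\<lambda>x::point. x $ i) differentiable (at z)" for i
    by (intro bounded_linear_imp_differentiable bounded_linear_vec_nth)
  have "(\<lambda>x::point. a + b * x$1 + c * x$2 + d * (x$1)\<^sup>2 + e * (x$1 * x$2) + f * (x$2)\<^sup>2) differentiable (at z)"
    by (intro differentiable_add differentiable_mult differentiable_power differentiable_const nth)
  then show ?thesis by (simp add: p[abs_def])
qed

lemma grad_add:
  assumes "p differentiable (at z)" "q differentiable (at z)"
  shows "grad (\<lambda>x. p x + q x) z = grad p z + grad q z"
proof -
  have "((\<lambda>x. p x + q x) has_derivative
      (\<lambda>h. frechet_derivative p (at z) h + frechet_derivative q (at z) h)) (at z)"
    using assms by (intro has_derivative_add) (simp_all add: frechet_derivative_works)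
  from frechet_derivative_at[OF this, symmetric] show ?thesis by (simp add: grad_def vec_eq_iff)
qed

lemma grad_mult:
  assumes "p differentiable (at z)"
  shows "grad (\<lambda>x. r * p x) z = r *\<^sub>R grad p z"
proof -
  have "((\<lambda>x. r * p x) has_derivative (\<lambda>h. r * frechet_derivative p (at z) h)) (at z)"
    using assms by (intro has_derivative_mult_right) (simp add: frechet_derivative_works)
  from frechet_derivative_at[OF this, symmetric] show ?thesis by (simp add: grad_def vec_eq_iff)
qed

text \<open>Minimality compares squares, whereas orthogonality of the residual is linear jointly in
  \<open>p\<close> and \<open>v\<close>. The equivalence is read off from \<open>expand\<close>, the
  error along the line \<open>p + t q\<close>.\<close>

lemma least_squares_iff_orthogonal:
  "is_arg_min (fit_error D v z) (\<lambda>p. p \<in> quadratics) p \<longleftrightarrow>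
     p \<in> quadratics \<and> (\<forall>q\<in>quadratics. (\<Sum>y\<in>nodes (patch D z). (p y - v y) * q y) = 0)"
proof -
  let ?N = "nodes (patch D z)"
  have expand: "fit_error D v z (\<lambda>x. p x + t * q x) =
      fit_error D v z p + 2 * t * (\<Sum>y\<in>?N. (p y - v y) * q y) + t\<^sup>2 * (\<Sum>y\<in>?N. (q y)\<^sup>2)" for p q t
  proof -
    have "(p y + t * q y - v y)\<^sup>2 = (p y - v y)\<^sup>2 + 2 * t * ((p y - v y) * q y) + t\<^sup>2 * (q y)\<^sup>2" for y
      by (simp add: power2_eq_square algebra_simps)
    then show ?thesis by (simp add: fit_error_def sum.distrib sum_distrib_left)
  qed
  show ?thesis
  proof (intro iffI conjI ballI)
    assume min: "is_arg_min (fit_error D v z) (\<lambda>p. p \<in> quadratics) p"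
    then show p: "p \<in> quadratics" by (simp add: is_arg_min_def)
    fix q assume q: "q \<in> quadratics"
    define S where "S = (\<Sum>y\<in>?N. (p y - v y) * q y)"
    define R where "R = (\<Sum>y\<in>?N. (q y)\<^sup>2)"
    have R: "R \<ge> 0" unfolding R_def by (intro sum_nonneg) simp
    have "\<not> fit_error D v z (\<lambda>x. p x + t * q x) < fit_error D v z p" for t
      using min quadratics_add[OF p quadratics_mult[OF q, of t]] by (auto simp: is_arg_min_def)
    then have "0 \<le> 2 * t * S + t\<^sup>2 * R" for t
      unfolding expand S_def[symmetric] R_def[symmetric] by (metis add.assoc add_le_same_cancel1 linorder_not_less le_add_same_cancel1)
    note nonneg = this
    \<comment> \<open>Up to sign the minimiser is \<open>S / R\<close>; \<open>R + 1\<close> avoids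
      a zero divisor. At \<open>- t\<close> the nonnegative expression equals
      \<open>- t^2 (R + 2)\<close>, which forces \<open>t = 0\<close>.\<close>
    define t where "t = S / (R + 1)"
    have S: "S = t * (R + 1)" using R by (simp add: t_def)
    have "0 \<le> - (t\<^sup>2 * (R + 2))"
      using nonneg[of "- t"] unfolding S by (simp add: power2_eq_square algebra_simps)
    then have "t = 0" using R by (auto simp: mult_le_0_iff)
    then show "S = 0" by (simp add: S)
  next
    assume *: "p \<in> quadratics \<and> (\<forall>q\<in>quadratics. (\<Sum>y\<in>?N. (p y - v y) * q y) = 0)"
    have "fit_error D v z p \<le> fit_error D v z q" if q: "q \<in> quadratics" for q
    proof -
      \<comment> \<open>The difference of \<open>q\<close> and \<open>p\<close>, written to fit the
        closure rules for quadratics. At \<open>t = 1\<close> the mixed term vanishes and a sum of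
        squares remains.\<close>
      let ?d = "\<lambda>x. q x + (- 1) * p x"
      have "?d \<in> quadratics" using q * quadratics_add quadratics_mult by blast
      then have "(\<Sum>y\<in>?N. (p y - v y) * ?d y) = 0" using * by (rule bspec[OF conjunct2, rotated])
      moreover have "(\<Sum>y\<in>?N. (?d y)\<^sup>2) \<ge> 0" by (intro sum_nonneg) simp
      ultimately show ?thesis using expand[of p 1 ?d] by simp
    qed
    then show "is_arg_min (fit_error D v z) (\<lambda>p. p \<in> quadratics) p"
      using * by (auto simp: is_arg_min_def not_less)
  qed
qed

section \<open>Vector-valued piecewise affine fields\<close>

lemma affine_fun_on_vec_lambda:
  fixes f :: "'n::finite \<Rightarrow> point \<Rightarrow> 'b::real_vector"
  assumes "\<And>i. affine_fun_on K (f i)" shows "affine_fun_on K (\<lambda>x. \<chi> i. f i x)"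
proof -
  have "\<forall>i. \<exists>L c. linear L \<and> (\<forall>x\<in>K. f i x = L x + c)" using assms unfolding affine_fun_on_def by blast
  then obtain L c where L: "\<And>i. linear (L i)" "\<And>i x. x \<in> K \<Longrightarrow> f i x = L i x + c i" by metis
  show ?thesis unfolding affine_fun_on_def
  proof (intro exI[of _ "\<lambda>x. \<chi> i. L i x"] exI[of _ "\<chi> i. c i"] conjI ballI)
    show "linear (\<lambda>x. \<chi> i. L i x)"
      using L(1) by (auto simp: linear_iff vec_eq_iff)
  qed (simp add: L(2) vec_eq_iff)
qed

lemma P1_space_iff:
  "triangulated_body D \<Longrightarrow> v \<in> P1_space D \<longleftrightarrow> (\<forall>K\<in>tris D. affine_fun_on K v)"
  using piecewise_affine_continuous_on[OF triangulated_bodyD(2), of D v]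
  by (auto simp: P1_space_def triangulated_bodyD(4))

lemma vec_fields_P1_iff:
  assumes D: "triangulated_body D"
  shows "v \<in> vec_fields (P1_space D) \<longleftrightarrow> (\<forall>K\<in>tris D. affine_fun_on K v)"
proof -
  have "affine_fun_on K v \<longleftrightarrow> (\<forall>i. affine_fun_on K (\<lambda>x. v x $ i))" for K
  proof
    assume "\<forall>i. affine_fun_on K (\<lambda>x. v x $ i)"
    then have "affine_fun_on K (\<lambda>x. \<chi> i. v x $ i)" by (intro affine_fun_on_vec_lambda) auto
    then show "affine_fun_on K v" by simp
  next
    assume v: "affine_fun_on K v"
    have "linear (\<lambda>x::real^2. x $ i)" for i by (simp add: linear_iff)
    from affine_fun_on_linear_image[OF v this] show "\<forall>i. affine_fun_on K (\<lambda>x. v x $ i)" ..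
  qed
  then show ?thesis unfolding vec_fields_def by (auto simp: P1_space_iff[OF D])
qed

lemma P1_fields_add:
  "triangulated_body D \<Longrightarrow> u \<in> vec_fields (P1_space D) \<Longrightarrow> v \<in> vec_fields (P1_space D) \<Longrightarrow>
    (\<lambda>x. u x + v x) \<in> vec_fields (P1_space D)"
  by (simp add: vec_fields_P1_iff affine_fun_on_add)

lemma P1_fields_scaleR:
  "triangulated_body D \<Longrightarrow> u \<in> vec_fields (P1_space D) \<Longrightarrow> (\<lambda>x. c *\<^sub>R u x) \<in> vec_fields (P1_space D)"
  by (simp add: vec_fields_P1_iff affine_fun_on_scaleR)

lemma P1_fields_continuous_on:
  "triangulated_body D \<Longrightarrow> u \<in> vec_fields (P1_space D) \<Longrightarrow> continuous_on (closure (region D)) u"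
  using piecewise_affine_continuous_on[OF triangulated_bodyD(2), of D u]
  by (simp add: vec_fields_P1_iff triangulated_bodyD(4))

lemma nodes_subset_closure:
  "triangulated_body D \<Longrightarrow> T \<subseteq> tris D \<Longrightarrow> nodes T \<subseteq> closure (region D)"
  using nodes_subset_Union triangulated_bodyD(4) by blast

section \<open>Fits and recovered gradients on admissible patches\<close>

context
  fixes D :: body
  assumes D: "triangulated_body D" and adm: "admissible_patches D"
begin

lemma patch_subset_tris: "patch D z \<subseteq> tris D"
proof -
  have "layer D z i \<subseteq> tris D" for i by (cases i) (auto simp: interface_tris_def)
  then show ?thesis by (simp add: patch_def)
qed

lemma least_squares_fit_unique:
  assumes "z \<in> nodes (interface_tris D)" "v \<in> P1_space D"
  shows "\<exists>!p. is_arg_min (fit_error D v z) (\<lambda>p. p \<in> quadratics) p"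
  using adm assms unfolding admissible_patches_def by blast

lemma quadratic_fit_least_squares:
  assumes "z \<in> nodes (interface_tris D)" "v \<in> P1_space D"
  shows "is_arg_min (fit_error D v z) (\<lambda>p. p \<in> quadratics) (quadratic_fit D v z)"
  unfolding quadratic_fit_def by (rule theI'[OF least_squares_fit_unique[OF assms]])

lemma quadratic_fit_eqI:
  assumes "z \<in> nodes (interface_tris D)" "v \<in> P1_space D"
    and "is_arg_min (fit_error D v z) (\<lambda>p. p \<in> quadratics) p"
  shows "quadratic_fit D v z = p"
  unfolding quadratic_fit_def
  by (rule the1_equality[OF least_squares_fit_unique[OF assms(1,2)]]) fact

text \<open>The sum of the two fits satisfies the orthogonality conditions for the summed data, and
  uniqueness on admissible patches identifies it with the fit.\<close>

lemma quadratic_fit_add: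
  assumes z: "z \<in> nodes (interface_tris D)" and u: "u \<in> P1_space D" and v: "v \<in> P1_space D"
  shows "quadratic_fit D (\<lambda>x. u x + v x) z = (\<lambda>x. quadratic_fit D u z x + quadratic_fit D v z x)"
proof (rule quadratic_fit_eqI[OF z])
  show "(\<lambda>x. u x + v x) \<in> P1_space D" using u v by (simp add: P1_space_iff[OF D] affine_fun_on_add)
  let ?p = "quadratic_fit D u z" and ?q = "quadratic_fit D v z"
  have *: "(\<Sum>y\<in>N. (p y + q y - (u y + v y)) * r y) =
      (\<Sum>y\<in>N. (p y - u y) * r y) + (\<Sum>y\<in>N. (q y - v y) * r y)" for p q r :: "point \<Rightarrow> real" and N
    by (simp add: sum.distrib[symmetric] algebra_simps)
  show "is_arg_min (fit_error D (\<lambda>x. u x + v x) z) (\<lambda>p. p \<in> quadratics) (\<lambda>x. ?p x + ?q x)"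
    using quadratic_fit_least_squares[OF z u] quadratic_fit_least_squares[OF z v]
    unfolding least_squares_iff_orthogonal * by (auto intro: quadratics_add)
qed

lemma quadratic_fit_mult:
  assumes z: "z \<in> nodes (interface_tris D)" and u: "u \<in> P1_space D"
  shows "quadratic_fit D (\<lambda>x. c * u x) z = (\<lambda>x. c * quadratic_fit D u z x)"
proof (rule quadratic_fit_eqI[OF z])
  show "(\<lambda>x. c * u x) \<in> P1_space D"
    using u affine_fun_on_scaleR[of _ u c] by (simp add: P1_space_iff[OF D])
  let ?p = "quadratic_fit D u z"
  have *: "(\<Sum>y\<in>N. (c * p y - c * u y) * r y) = c * (\<Sum>y\<in>N. (p y - u y) * r y)"
    for p r :: "point \<Rightarrow> real" and N
    by (simp add: sum_distrib_left algebra_simps)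
  show "is_arg_min (fit_error D (\<lambda>x. c * u x) z) (\<lambda>p. p \<in> quadratics) (\<lambda>x. c * ?p x)"
    using quadratic_fit_least_squares[OF z u]
    unfolding least_squares_iff_orthogonal * by (auto intro: quadratics_mult)
qed

lemma quadratic_fit_cong:
  assumes "\<And>x. x \<in> closure (region D) \<Longrightarrow> u x = v x"
  shows "quadratic_fit D u z = quadratic_fit D v z"
proof -
  have "u y = v y" if "y \<in> nodes (patch D z)" for y
    using assms that nodes_subset_closure[OF D patch_subset_tris] by blast
  then have "fit_error D u z = fit_error D v z" unfolding fit_error_def by (intro ext sum.cong) auto
  then show ?thesis by (simp add: quadratic_fit_def)
qed

text \<open>The predicate under the \<open>THE\<close> of \<open>recovered_grad\<close>, named so
  that a candidate can be checked against it.\<close>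

definition is_recovered_grad :: "(point \<Rightarrow> real) \<Rightarrow> (point \<Rightarrow> real^2) \<Rightarrow> bool" where
  "is_recovered_grad v G \<longleftrightarrow> continuous_on (\<Union>(interface_tris D)) G \<and>
     (\<forall>K\<in>interface_tris D. affine_fun_on K G) \<and>
     (\<forall>z\<in>nodes (interface_tris D). G z = grad (quadratic_fit D v z) z) \<and>
     (\<forall>x. x \<notin> \<Union>(interface_tris D) \<longrightarrow> G x = 0)"

lemma is_recovered_grad_unique:
  assumes "is_recovered_grad v G" "is_recovered_grad v G'" shows "G = G'"
proof
  fix x show "G x = G' x"
  proof (cases "x \<in> \<Union>(interface_tris D)")
    case True
    show ?thesis
      by (rule piecewise_affine_unique[OF triangulation_interface_tris[OF D] _ _ _ True])
        (use assms in \<open>simp_all add: is_recovered_grad_def\<close>)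
  next
    case False
    then show ?thesis using assms by (simp add: is_recovered_grad_def)
  qed
qed

text \<open>Valid for arbitrary \<open>v\<close>: whatever \<open>quadratic_fit\<close> denotes, its
  gradients at the nodes are nodal values, and these have exactly one piecewise affine interpolant
  extended by zero. \<open>P1_space\<close> enters when fits are added or scaled.\<close>

lemma recovered_grad_is_recovered_grad: "is_recovered_grad v (recovered_grad D v)"
proof -
  obtain G where G: "is_recovered_grad v G"
    using piecewise_affine_interpolation[OF triangulation_interface_tris[OF D],
        of "\<lambda>z. grad (quadratic_fit D v z) z"]
    unfolding is_recovered_grad_def by blast
  have "recovered_grad D v = (THE G. is_recovered_grad v G)"
    by (simp add: recovered_grad_def is_recovered_grad_def)
  then show ?thesis using theI[of "is_recovered_grad v", OF G is_recovered_grad_unique[OF _ G]] by simp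
qed

lemma recovered_grad_eqI: "is_recovered_grad v G \<Longrightarrow> recovered_grad D v = G"
  by (rule is_recovered_grad_unique[OF recovered_grad_is_recovered_grad])

lemma recovered_grad_affine: "K \<in> interface_tris D \<Longrightarrow> affine_fun_on K (recovered_grad D v)"
  using recovered_grad_is_recovered_grad[of v] by (simp add: is_recovered_grad_def)

lemma grad_quadratic_fit_differentiable:
  "z \<in> nodes (interface_tris D) \<Longrightarrow> v \<in> P1_space D \<Longrightarrow> quadratic_fit D v z differentiable (at z)"
  using quadratic_fit_least_squares quadratics_differentiable by (simp add: is_arg_min_def)

lemma recovered_grad_add:
  assumes u: "u \<in> P1_space D" and v: "v \<in> P1_space D"
  shows "recovered_grad D (\<lambda>x. u x + v x) = (\<lambda>x. recovered_grad D u x + recovered_grad D v x)"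
proof (rule recovered_grad_eqI)
  show "is_recovered_grad (\<lambda>x. u x + v x) (\<lambda>x. recovered_grad D u x + recovered_grad D v x)"
    using recovered_grad_is_recovered_grad[of u] recovered_grad_is_recovered_grad[of v]
    unfolding is_recovered_grad_def
    by (auto intro!: continuous_on_add affine_fun_on_add
        simp: quadratic_fit_add u v grad_add grad_quadratic_fit_differentiable)
qed

lemma recovered_grad_mult:
  assumes u: "u \<in> P1_space D"
  shows "recovered_grad D (\<lambda>x. c * u x) = (\<lambda>x. c *\<^sub>R recovered_grad D u x)"
proof (rule recovered_grad_eqI)
  show "is_recovered_grad (\<lambda>x. c * u x) (\<lambda>x. c *\<^sub>R recovered_grad D u x)"
    using recovered_grad_is_recovered_grad[of u]
    unfolding is_recovered_grad_def
    by (auto intro!: continuous_on_scaleR continuous_on_const affine_fun_on_scaleR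
        simp: quadratic_fit_mult u grad_mult grad_quadratic_fit_differentiable)
qed

lemma recovered_grad_cong:
  assumes "\<And>x. x \<in> closure (region D) \<Longrightarrow> u x = v x"
  shows "recovered_grad D u = recovered_grad D v"
proof -
  have "quadratic_fit D u z = quadratic_fit D v z" for z by (rule quadratic_fit_cong) (rule assms)
  then show ?thesis by (simp only: recovered_grad_def)
qed

lemma recovered_jacobian_affine: "K \<in> interface_tris D \<Longrightarrow> affine_fun_on K (recovered_jacobian D v)"
  unfolding recovered_jacobian_def[abs_def] by (intro affine_fun_on_vec_lambda recovered_grad_affine)

lemma recovered_jacobian_add:
  assumes "u \<in> vec_fields (P1_space D)" "v \<in> vec_fields (P1_space D)"
  shows "recovered_jacobian D (\<lambda>x. u x + v x) = (\<lambda>x. recovered_jacobian D u x + recovered_jacobian D v x)"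
  using assms by (auto simp: recovered_jacobian_def recovered_grad_add vec_fields_def fun_eq_iff vec_eq_iff)

lemma recovered_jacobian_scaleR:
  assumes "u \<in> vec_fields (P1_space D)"
  shows "recovered_jacobian D (\<lambda>x. c *\<^sub>R u x) = (\<lambda>x. c *\<^sub>R recovered_jacobian D u x)"
  using assms by (auto simp: recovered_jacobian_def recovered_grad_mult vec_fields_def fun_eq_iff vec_eq_iff)

lemma recovered_jacobian_cong:
  assumes "\<And>x. x \<in> closure (region D) \<Longrightarrow> u x = v x"
  shows "recovered_jacobian D u = recovered_jacobian D v"
proof -
  have "recovered_grad D (\<lambda>x. u x $ i) = recovered_grad D (\<lambda>x. v x $ i)" for i
    by (rule recovered_grad_cong) (simp add: assms)
  then show ?thesis by (simp add: recovered_jacobian_def[abs_def])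
qed

end

section \<open>Linear functionals on finite element fields\<close>

text \<open>A linear functional on fields modulo their values off the closed domain. The last clause
  makes it well defined there, so that a field may be exchanged for its nodal expansion, which
  agrees with it only on the closed domain.\<close>

definition P1_functional :: "body \<Rightarrow> ((point \<Rightarrow> real^2) \<Rightarrow> real) \<Rightarrow> bool" where
  "P1_functional D \<Phi> \<longleftrightarrow>
     (\<forall>u\<in>vec_fields (P1_space D). \<forall>v\<in>vec_fields (P1_space D). \<Phi> (\<lambda>x. u x + v x) = \<Phi> u + \<Phi> v) \<and>
     (\<forall>c. \<forall>u\<in>vec_fields (P1_space D). \<Phi> (\<lambda>x. c *\<^sub>R u x) = c * \<Phi> u) \<and>
     (\<forall>u\<in>vec_fields (P1_space D). \<forall>v\<in>vec_fields (P1_space D).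
        (\<forall>x\<in>closure (region D). u x = v x) \<longrightarrow> \<Phi> u = \<Phi> v)"

lemma P1_functionalD:
  assumes "P1_functional D \<Phi>" "u \<in> vec_fields (P1_space D)"
  shows "v \<in> vec_fields (P1_space D) \<Longrightarrow> \<Phi> (\<lambda>x. u x + v x) = \<Phi> u + \<Phi> v"
    and "\<Phi> (\<lambda>x. c *\<^sub>R u x) = c * \<Phi> u"
    and "v \<in> vec_fields (P1_space D) \<Longrightarrow> (\<And>x. x \<in> closure (region D) \<Longrightarrow> u x = v x) \<Longrightarrow> \<Phi> u = \<Phi> v"
proof -
  note * = assms(1)[unfolded P1_functional_def]
  show "v \<in> vec_fields (P1_space D) \<Longrightarrow> \<Phi> (\<lambda>x. u x + v x) = \<Phi> u + \<Phi> v"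
    by (rule *[THEN conjunct1, rule_format, OF assms(2)])
  show "\<Phi> (\<lambda>x. c *\<^sub>R u x) = c * \<Phi> u"
    by (rule *[THEN conjunct2, THEN conjunct1, rule_format, OF assms(2)])
  show "\<Phi> u = \<Phi> v" if "v \<in> vec_fields (P1_space D)" "\<And>x. x \<in> closure (region D) \<Longrightarrow> u x = v x"
    using *[THEN conjunct2, THEN conjunct2, rule_format, OF assms(2) that(1)] that(2) by blast
qed

lemma P1_fields_sum:
  assumes D: "triangulated_body D" and "\<And>i. i \<in> I \<Longrightarrow> f i \<in> vec_fields (P1_space D)"
  shows "(\<lambda>x. \<Sum>i\<in>I. f i x) \<in> vec_fields (P1_space D)"
  using assms(2) by (auto simp: vec_fields_P1_iff[OF D] intro!: affine_fun_on_sum)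

lemma P1_functional_sum:
  assumes D: "triangulated_body D" and \<Phi>: "P1_functional D \<Phi>"
    and I: "finite I" "\<And>i. i \<in> I \<Longrightarrow> f i \<in> vec_fields (P1_space D)"
  shows "\<Phi> (\<lambda>x. \<Sum>i\<in>I. f i x) = (\<Sum>i\<in>I. \<Phi> (f i))"
  using I
proof (induction I)
  case empty
  have "(\<lambda>x. 0) \<in> vec_fields (P1_space D)" by (simp add: vec_fields_P1_iff[OF D] affine_fun_on_zero)
  from P1_functionalD(2)[OF \<Phi> this, of 0] show ?case by simp
next
  case (insert i I)
  have "(\<lambda>x. \<Sum>i\<in>I. f i x) \<in> vec_fields (P1_space D)" using insert.prems by (intro P1_fields_sum[OF D]) auto
  then have "\<Phi> (\<lambda>x. f i x + (\<Sum>i\<in>I. f i x)) = \<Phi> (f i) + \<Phi> (\<lambda>x. \<Sum>i\<in>I. f i x)"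
    using insert.prems by (intro P1_functionalD(1)[OF \<Phi>]) auto
  then show ?case using insert by simp
qed

section \<open>Hat functions and nodal expansions\<close>

definition hat :: "body \<Rightarrow> point \<Rightarrow> point \<Rightarrow> real" where
  "hat D z = (SOME h. (\<forall>K\<in>tris D. affine_fun_on K h) \<and>
     (\<forall>y\<in>nodes (tris D). h y = (if y = z then 1 else 0)))"

lemma hat:
  assumes D: "triangulated_body D"
  shows "K \<in> tris D \<Longrightarrow> affine_fun_on K (hat D z)"
    and "y \<in> nodes (tris D) \<Longrightarrow> hat D z y = (if y = z then 1 else 0)"
proof -
  have "\<exists>h. (\<forall>K\<in>tris D. affine_fun_on K h) \<and> (\<forall>y\<in>nodes (tris D). h y = (if y = z then 1 else 0 :: real))"
    using piecewise_affine_interpolation[OF triangulated_bodyD(2)[OF D], of "\<lambda>y. if y = z then 1 else 0 :: real"]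
    by blast
  from someI_ex[OF this] have "(\<forall>K\<in>tris D. affine_fun_on K (hat D z)) \<and>
      (\<forall>y\<in>nodes (tris D). hat D z y = (if y = z then 1 else 0))"
    unfolding hat_def .
  then show "K \<in> tris D \<Longrightarrow> affine_fun_on K (hat D z)"
    "y \<in> nodes (tris D) \<Longrightarrow> hat D z y = (if y = z then 1 else 0)" by auto
qed

lemma hat_field:
  assumes D: "triangulated_body D"
  shows "(\<lambda>x. hat D z x *\<^sub>R (c :: real^2)) \<in> vec_fields (P1_space D)"
  unfolding vec_fields_P1_iff[OF D]
proof
  fix K assume "K \<in> tris D"
  moreover have "linear (\<lambda>t. t *\<^sub>R c)" by (simp add: linear_iff scaleR_add_left)
  ultimately show "affine_fun_on K (\<lambda>x. hat D z x *\<^sub>R c)"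
    using hat(1)[OF D] affine_fun_on_linear_image by blast
qed

lemma hat_expansion:
  assumes D: "triangulated_body D" and v: "v \<in> vec_fields (P1_space D)" and x: "x \<in> closure (region D)"
  shows "v x = (\<Sum>z\<in>nodes (tris D). hat D z x *\<^sub>R v z)"
proof (rule piecewise_affine_unique[OF triangulated_bodyD(2)[OF D],
      where f = v and g = "\<lambda>x. \<Sum>z\<in>nodes (tris D). hat D z x *\<^sub>R v z"])
  show "affine_fun_on K v" if "K \<in> tris D" for K using v that by (simp add: vec_fields_P1_iff[OF D])
  have "(\<lambda>x. \<Sum>z\<in>nodes (tris D). hat D z x *\<^sub>R v z) \<in> vec_fields (P1_space D)"
    by (intro P1_fields_sum hat_field D)
  then show "affine_fun_on K (\<lambda>x. \<Sum>z\<in>nodes (tris D). hat D z x *\<^sub>R v z)" if "K \<in> tris D" for K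
    using that by (simp add: vec_fields_P1_iff[OF D])
  show "x \<in> \<Union>(tris D)" using x by (simp add: triangulated_bodyD(4)[OF D])
  fix y assume y: "y \<in> nodes (tris D)"
  have "(\<Sum>z\<in>nodes (tris D). hat D z y *\<^sub>R v z) = (\<Sum>z\<in>nodes (tris D). if z = y then v z else 0)"
    using hat(2)[OF D y] by (intro sum.cong) auto
  then show "v y = (\<Sum>z\<in>nodes (tris D). hat D z y *\<^sub>R v z)"
    using y finite_nodes[OF triangulated_bodyD(2)[OF D]] by simp
qed

text \<open>The limit is identified as an explicit combination of hat functions, weighted by the
  limits of the nodal values. Pointwise convergence therefore already preserves affinity on each
  triangle.\<close>

lemma P1_limit:
  assumes D: "triangulated_body D" and u: "\<And>k. u k \<in> vec_fields (P1_space D)"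
    and lim: "\<And>x. x \<in> closure (region D) \<Longrightarrow> (\<lambda>k. u k x) \<longlonglongrightarrow> v x"
  shows "v \<in> vec_fields (P1_space D)"
proof -
  let ?w = "\<lambda>x. \<Sum>z\<in>nodes (tris D). hat D z x *\<^sub>R v z"
  have "v x = ?w x" if x: "x \<in> closure (region D)" for x
  proof (rule LIMSEQ_unique[OF lim[OF x]])
    have "(\<lambda>k. \<Sum>z\<in>nodes (tris D). hat D z x *\<^sub>R u k z) \<longlonglongrightarrow> ?w x"
      using nodes_subset_closure[OF D order_refl] by (intro tendsto_intros lim) auto
    then show "(\<lambda>k. u k x) \<longlonglongrightarrow> ?w x" using hat_expansion[OF D u x] by simp
  qed
  moreover have "?w \<in> vec_fields (P1_space D)" by (intro P1_fields_sum hat_field D)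
  ultimately show ?thesis
    unfolding vec_fields_P1_iff[OF D] triangulated_bodyD(4)[OF D, symmetric]
    by (metis (no_types, lifting) UnionI affine_fun_on_cong)
qed

lemma V_limit:
  assumes D: "triangulated_body D" and u: "\<And>k. u k \<in> vec_fields (V_space D)"
    and lim: "\<And>x. x \<in> closure (region D) \<Longrightarrow> (\<lambda>k. u k x) \<longlonglongrightarrow> v x"
  shows "v \<in> vec_fields (V_space D)"
proof -
  have "u k \<in> vec_fields (P1_space D)" for k using u by (auto simp: vec_fields_def V_space_def)
  then have "v \<in> vec_fields (P1_space D)" by (rule P1_limit[OF D _ lim])
  moreover have "v x $ i = 0" if x: "x \<in> outer_boundary D" for x i
  proof -
    have "x \<in> closure (region D)" using x by (auto simp: outer_boundary_def frontier_def)
    then have "(\<lambda>k. u k x $ i) \<longlonglongrightarrow> v x $ i" by (intro tendsto_vec_nth lim)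
    moreover have "u k x $ i = 0" for k using u x by (auto simp: vec_fields_def V_space_def)
    ultimately show ?thesis by (simp add: LIMSEQ_const_iff)
  qed
  ultimately show ?thesis by (auto simp: vec_fields_def V_space_def)
qed

text \<open>After expansion the values of \<open>\<Phi>\<close> on the hat fields are fixed
  coefficients, and only finitely many nodal values depend on \<open>k\<close>. Linearity thus
  yields continuity along such sequences without choosing a norm.\<close>

lemma P1_functional_tendsto:
  assumes D: "triangulated_body D" and \<Phi>: "P1_functional D \<Phi>"
    and u: "\<And>k. u k \<in> vec_fields (P1_space D)"
    and lim: "\<And>x. x \<in> closure (region D) \<Longrightarrow> (\<lambda>k. u k x) \<longlonglongrightarrow> v x"
  shows "(\<lambda>k. \<Phi> (u k)) \<longlonglongrightarrow> \<Phi> v"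
proof -
  let ?N = "nodes (tris D)"
  have N: "finite ?N" by (rule finite_nodes[OF triangulated_bodyD(2)[OF D]])
  have expand: "\<Phi> w = (\<Sum>z\<in>?N. \<Sum>i\<in>UNIV. w z $ i * \<Phi> (\<lambda>x. hat D z x *\<^sub>R axis i 1))"
    if w: "w \<in> vec_fields (P1_space D)" for w
  proof -
    let ?b = "\<lambda>z i x. w z $ i *\<^sub>R (hat D z x *\<^sub>R (axis i 1 :: real^2))"
    have b: "?b z i \<in> vec_fields (P1_space D)" for z i
      by (intro P1_fields_scaleR hat_field D)
    have s: "(\<lambda>x. \<Sum>i\<in>UNIV. ?b z i x) \<in> vec_fields (P1_space D)" for z
      by (intro P1_fields_sum b D)
    have "w x = (\<Sum>z\<in>?N. \<Sum>i\<in>UNIV. ?b z i x)" if "x \<in> closure (region D)" for x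
    proof -
      have "hat D z x *\<^sub>R w z = (\<Sum>i\<in>UNIV. ?b z i x)" for z
        by (simp add: vec_eq_iff axis_def if_distrib[of "\<lambda>t. _ * t"] cong: if_cong)
      then show ?thesis using hat_expansion[OF D w that] by simp
    qed
    then have "\<Phi> w = \<Phi> (\<lambda>x. \<Sum>z\<in>?N. \<Sum>i\<in>UNIV. ?b z i x)"
      by (intro P1_functionalD(3)[OF \<Phi> w] P1_fields_sum[OF D] s)
    also have "\<dots> = (\<Sum>z\<in>?N. \<Phi> (\<lambda>x. \<Sum>i\<in>UNIV. ?b z i x))"
      by (rule P1_functional_sum[OF D \<Phi> N]) (rule s)
    also have "\<dots> = (\<Sum>z\<in>?N. \<Sum>i\<in>UNIV. \<Phi> (?b z i))"
      by (intro sum.cong refl P1_functional_sum[OF D \<Phi>] b) auto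
    also have "\<dots> = (\<Sum>z\<in>?N. \<Sum>i\<in>UNIV. w z $ i * \<Phi> (\<lambda>x. hat D z x *\<^sub>R axis i 1))"
      by (intro sum.cong refl P1_functionalD(2)[OF \<Phi>] hat_field[OF D])
    finally show ?thesis .
  qed
  have v: "v \<in> vec_fields (P1_space D)" by (rule P1_limit[OF D u lim])
  show ?thesis unfolding expand[OF u] expand[OF v]
    using nodes_subset_closure[OF D order_refl] by (intro tendsto_intros lim) auto
qed

text \<open>Linearity of the integrand is asked for almost everywhere only: Jacobians are
  uncontrolled on the frontiers of triangles, and interface terms off the interface. Essential
  boundedness supplies the integrability by which the integral splits.\<close>

lemma P1_functional_integral:
  assumes M: "finite_measure M"
    and bd: "\<And>u. u \<in> vec_fields (P1_space D) \<Longrightarrow> ess_bounded M (I u :: point \<Rightarrow> real)"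
    and add: "\<And>u v. u \<in> vec_fields (P1_space D) \<Longrightarrow> v \<in> vec_fields (P1_space D) \<Longrightarrow>
      (\<lambda>x. u x + v x) \<in> vec_fields (P1_space D) \<Longrightarrow> AE x in M. I (\<lambda>x. u x + v x) x = I u x + I v x"
    and scale: "\<And>c u. u \<in> vec_fields (P1_space D) \<Longrightarrow>
      (\<lambda>x. c *\<^sub>R u x) \<in> vec_fields (P1_space D) \<Longrightarrow> AE x in M. I (\<lambda>x. c *\<^sub>R u x) x = c * I u x"
    and cong: "\<And>u v. u \<in> vec_fields (P1_space D) \<Longrightarrow> v \<in> vec_fields (P1_space D) \<Longrightarrow>
      (\<And>x. x \<in> closure (region D) \<Longrightarrow> u x = v x) \<Longrightarrow> AE x in M. I u x = I v x"
    and D: "triangulated_body D"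
  shows "P1_functional D (\<lambda>u. LINT x|M. I u x)"
proof -
  have int: "integrable M (I u)" and meas: "I u \<in> borel_measurable M" if "u \<in> vec_fields (P1_space D)" for u
    using ess_bounded_integrable[OF M bd[OF that]] by auto
  show ?thesis
    unfolding P1_functional_def
  proof (intro conjI ballI allI impI)
    fix u v assume uv: "u \<in> vec_fields (P1_space D)" "v \<in> vec_fields (P1_space D)"
    have "(LINT x|M. I (\<lambda>x. u x + v x) x) = (LINT x|M. I u x + I v x)"
      using uv by (intro integral_cong_AE meas add borel_measurable_add P1_fields_add[OF D])
    then show "(LINT x|M. I (\<lambda>x. u x + v x) x) = (LINT x|M. I u x) + (LINT x|M. I v x)"
      using int uv by simp
    show "(LINT x|M. I u x) = (LINT x|M. I v x)" if "\<forall>x\<in>closure (region D). u x = v x"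
      using uv that by (intro integral_cong_AE meas cong) auto
  next
    fix u c assume u: "u \<in> vec_fields (P1_space D)"
    have "(LINT x|M. I (\<lambda>x. c *\<^sub>R u x) x) = (LINT x|M. c * I u x)"
      using u by (intro integral_cong_AE meas scale borel_measurable_times borel_measurable_const P1_fields_scaleR[OF D])
    then show "(LINT x|M. I (\<lambda>x. c *\<^sub>R u x) x) = c * (LINT x|M. I u x)" by simp
  qed
qed

section \<open>Jacobians and null sets in the region\<close>

lemma frechet_derivative_within_cong_affine:
  fixes f g :: "point \<Rightarrow> 'b::real_normed_vector"
  assumes K: "convex K" "interior K \<noteq> {}" "x \<in> K" and "affine_fun_on K f" "\<And>y. y \<in> K \<Longrightarrow> f y = g y"
  shows "frechet_derivative f (at x within K) = frechet_derivative g (at x within K)"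
proof -
  obtain L c where L: "linear L" "\<forall>x\<in>K. f x = L x + c"
    using assms(4) unfolding affine_fun_on_def by blast
  then show ?thesis
    using frechet_derivative_within_affine[OF K, of L f c] frechet_derivative_within_affine[OF K, of L g c] assms(5)
    by auto
qed

lemma jacobian_within_affine:
  fixes f g :: "point \<Rightarrow> real^2"
  assumes K: "convex K" "interior K \<noteq> {}" "x \<in> K" and f: "affine_fun_on K f"
  shows "affine_fun_on K g \<Longrightarrow>
      jacobian (\<lambda>y. f y + g y) (at x within K) = jacobian f (at x within K) + jacobian g (at x within K)"
    and "jacobian (\<lambda>y. c *\<^sub>R f y) (at x within K) = c *\<^sub>R jacobian f (at x within K)"
    and "(\<And>y. y \<in> K \<Longrightarrow> f y = g y) \<Longrightarrow> jacobian f (at x within K) = jacobian g (at x within K)"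
    and "y \<in> K \<Longrightarrow> jacobian f (at x within K) = jacobian f (at y within K)"
  unfolding jacobian_def
  using frechet_derivative_within_add_affine[OF K f, of g] frechet_derivative_within_scaleR_affine[OF K f, of c]
    frechet_derivative_within_cong_affine[OF K f, of g] frechet_derivative_within_const_affine[OF K, of y f] f
  by (auto simp: matrix_def vec_eq_iff)

lemma triangle_facts:
  assumes "triangulated_body D" "K \<in> tris D"
  shows "convex K" "interior K \<noteq> {}" "closed K" "K \<subseteq> closure (region D)"
  using triangulated_bodyD(3)[OF assms] triangulated_bodyD(4)[OF assms(1)] assms(2)
  by (auto intro: convex_simplex closed_simplex dest: interior_triangle_nonempty)

lemma linear_stress_strain: "linear (\<lambda>A. stress D (strain A))"
  by (auto simp: linear_iff stress_def strain_def trace_def transpose_def vec_eq_iff sum_2 mat_def algebra_simps)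

lemma complete_measure_lebesgue_on:
  assumes "S \<in> sets lebesgue" shows "complete_measure (lebesgue_on S)"
proof
  fix A B assume AB: "B \<subseteq> A" "A \<in> null_sets (lebesgue_on S)"
  then have "A \<in> null_sets lebesgue" "A \<subseteq> S" using null_sets_restrict_space[OF assms] by auto
  then have "B \<in> sets lebesgue" "B \<subseteq> S"
    using AB(1) null_sets_completion_subset by blast+
  then show "B \<in> sets (lebesgue_on S)" using assms by (simp add: sets_restrict_space_iff)
qed

lemma finite_measure_lebesgue_on:
  fixes S :: "point set"
  assumes "open S" "bounded S" shows "finite_measure (lebesgue_on S)"
proof
  have "S \<in> lmeasurable" by (rule lmeasurable_open[OF assms(2,1)])
  then show "emeasure (lebesgue_on S) (space (lebesgue_on S)) \<noteq> \<infinity>"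
    by (auto simp: emeasure_restrict_space fmeasurable_def)
qed

text \<open>The frontier of a convex set is negligible and there are finitely many triangles. Any
  other point of the region lies in some closed triangle off its frontier, hence in its
  interior.\<close>

lemma AE_interior_triangle:
  assumes D: "triangulated_body D"
  shows "AE x in region_measure D. x \<in> \<Union>(interior ` tris D)"
proof -
  have "negligible (\<Union>(frontier ` tris D))"
    using triangulationD(1)[OF triangulated_bodyD(2)[OF D]] triangle_facts(1)[OF D]
    by (intro negligible_Union) (auto intro: negligible_convex_frontier)
  then have "AE x in lebesgue. x \<notin> \<Union>(frontier ` tris D)"
    unfolding negligible_iff_null_sets by (rule AE_not_in)
  then have "AE x in region_measure D. x \<notin> \<Union>(frontier ` tris D)"
    by (subst AE_restrict_space_iff) (use triangulated_bodyD(9)[OF D] in auto)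
  moreover have "AE x in region_measure D. x \<in> region D"
    by (rule AE_I2) (simp add: space_restrict_space)
  ultimately show ?thesis
  proof eventually_elim
    case (elim x)
    then have "x \<in> \<Union>(tris D)" using closure_subset[of "region D"] by (auto simp: triangulated_bodyD(4)[OF D])
    then obtain K where K: "K \<in> tris D" "x \<in> K" by blast
    then have "x \<in> interior K"
      using elim triangle_facts(3)[OF D K(1)] by (auto simp: frontier_def)
    then show ?case using K by blast
  qed
qed

section \<open>The terms of the discrete problem\<close>

lemma P1_functional_pairing:
  assumes M: "finite_measure M" and D: "triangulated_body D" and w: "ess_bounded M w"
    and bd: "\<And>u. u \<in> vec_fields (P1_space D) \<Longrightarrow> ess_bounded M (A u)"
    and add: "\<And>u v. u \<in> vec_fields (P1_space D) \<Longrightarrow> v \<in> vec_fields (P1_space D) \<Longrightarrow>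
      AE x in M. A (\<lambda>x. u x + v x) x = A u x + A v x"
    and scale: "\<And>c u. u \<in> vec_fields (P1_space D) \<Longrightarrow> AE x in M. A (\<lambda>x. c *\<^sub>R u x) x = c *\<^sub>R A u x"
    and cong: "\<And>u v. u \<in> vec_fields (P1_space D) \<Longrightarrow> v \<in> vec_fields (P1_space D) \<Longrightarrow>
      (\<And>x. x \<in> closure (region D) \<Longrightarrow> u x = v x) \<Longrightarrow> AE x in M. A u x = A v x"
  shows "P1_functional D (\<lambda>u. pairing M (A u) w)"
  unfolding pairing_def
proof (rule P1_functional_integral[OF M _ _ _ _ D])
  show "ess_bounded M (\<lambda>x. A u x \<bullet> w x)" if "u \<in> vec_fields (P1_space D)" for u
    by (rule ess_bounded_bilinear[OF bounded_bilinear_inner bd[OF that] w])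
  show "AE x in M. A (\<lambda>x. u x + v x) x \<bullet> w x = A u x \<bullet> w x + A v x \<bullet> w x"
    if "u \<in> vec_fields (P1_space D)" "v \<in> vec_fields (P1_space D)" for u v
    using add[OF that] by eventually_elim (simp add: inner_add_left)
  show "AE x in M. A (\<lambda>x. c *\<^sub>R u x) x \<bullet> w x = c * (A u x \<bullet> w x)" if "u \<in> vec_fields (P1_space D)" for c u
    using scale[OF that, of c] by eventually_elim simp
  show "AE x in M. A u x \<bullet> w x = A v x \<bullet> w x"
    if "u \<in> vec_fields (P1_space D)" "v \<in> vec_fields (P1_space D)" "\<And>x. x \<in> closure (region D) \<Longrightarrow> u x = v x" for u v
  proof -
    have "AE x in M. A u x = A v x" by (rule cong) (use that in auto)
    then show ?thesis by eventually_elim simp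
  qed
qed

text \<open>The elastic form differentiates with \<open>at x\<close> and not within a triangle. In
  an open triangle the two filters coincide, and \<open>interior K\<close> is itself convex with
  nonempty interior, so the rules for derivatives within a convex set apply to it.\<close>

lemma jacobian_at_affine:
  assumes D: "triangulated_body D" and x: "x \<in> \<Union>(interior ` tris D)"
    and u: "u \<in> vec_fields (P1_space D)"
  shows "v \<in> vec_fields (P1_space D) \<Longrightarrow>
      jacobian (\<lambda>y. u y + v y) (at x) = jacobian u (at x) + jacobian v (at x)"
    and "jacobian (\<lambda>y. c *\<^sub>R u y) (at x) = c *\<^sub>R jacobian u (at x)"
    and "(\<And>y. y \<in> closure (region D) \<Longrightarrow> u y = v y) \<Longrightarrow> jacobian u (at x) = jacobian v (at x)"
proof -
  obtain K where K: "K \<in> tris D" "x \<in> interior K" using x by blast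
  have i: "convex (interior K)" "interior (interior K) \<noteq> {}"
    using triangle_facts[OF D K(1)] by auto
  have at: "at x = at x within interior K" by (rule at_within_open[symmetric, OF K(2) open_interior])
  have aff: "affine_fun_on (interior K) f" if "f \<in> vec_fields (P1_space D)" for f
    by (rule affine_fun_on_subset[OF _ interior_subset])
      (use that K(1) in \<open>simp add: vec_fields_P1_iff[OF D]\<close>)
  note J = jacobian_within_affine[OF i K(2) aff[OF u]]
  show "jacobian (\<lambda>y. u y + v y) (at x) = jacobian u (at x) + jacobian v (at x)"
    if "v \<in> vec_fields (P1_space D)"
    unfolding at by (rule J(1)[OF aff[OF that]])
  show "jacobian (\<lambda>y. c *\<^sub>R u y) (at x) = c *\<^sub>R jacobian u (at x)" unfolding at by (rule J(2))
  show "jacobian u (at x) = jacobian v (at x)" if "\<And>y. y \<in> closure (region D) \<Longrightarrow> u y = v y"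
    unfolding at by (rule J(3)) (use that triangle_facts(4)[OF D K(1)] interior_subset in blast)
qed

lemma ess_bounded_jacobian:
  assumes D: "triangulated_body D" and u: "u \<in> vec_fields (P1_space D)"
  shows "ess_bounded (region_measure D) (\<lambda>x. jacobian u (at x))"
proof (rule piecewise_bounded_compose[where \<phi> = "\<lambda>x. x"])
  have "region D \<in> sets lebesgue" using triangulated_bodyD(9)[OF D] by auto
  then show "complete_measure (region_measure D)" "(\<lambda>x. x) \<in> borel_measurable (region_measure D)"
    by (auto intro: complete_measure_lebesgue_on continuous_imp_measurable_on_sets_lebesgue continuous_on_id)
  show "AE x in region_measure D. x \<in> \<Union>(interior ` tris D)" by (rule AE_interior_triangle[OF D])
  show "piecewise_bounded (\<Union>(interior ` tris D)) (\<lambda>x. jacobian u (at x))"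
  proof (rule piecewise_bounded_const_on_pieces)
    show "finite (interior ` tris D)" using triangulationD(1)[OF triangulated_bodyD(2)[OF D]] by simp
    show "interior ` tris D \<subseteq> sets borel" by auto
    fix A assume "A \<in> interior ` tris D"
    then obtain K where K: "K \<in> tris D" "A = interior K" by blast
    have i: "convex A" "interior A \<noteq> {}" using triangle_facts[OF D K(1)] by (auto simp: K(2))
    have aff: "affine_fun_on A u" unfolding K(2)
      by (rule affine_fun_on_subset[OF _ interior_subset])
        (use u K(1) in \<open>simp add: vec_fields_P1_iff[OF D]\<close>)
    obtain a where a: "a \<in> A" using i(2) interior_subset by blast
    have "jacobian u (at x) = jacobian u (at a)" if x: "x \<in> A" for x
      using jacobian_within_affine(4)[OF i x aff a] at_within_open[OF x] at_within_open[OF a] K(2) by simp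
    then show "\<exists>c. \<forall>x\<in>A. jacobian u (at x) = c" by blast
  qed
qed

lemma P1_functional_elastic_form:
  assumes D: "triangulated_body D" and w: "w \<in> vec_fields (P1_space D)"
  shows "P1_functional D (\<lambda>u. elastic_form D u w)"
  unfolding elastic_form_def
proof (rule P1_functional_integral[OF _ _ _ _ _ D])
  note S = linear_stress_strain[of D]
  let ?W = "\<lambda>x. strain (jacobian w (at x))"
  have lin: "linear strain" by (auto simp: linear_iff strain_def transpose_def vec_eq_iff algebra_simps)
  show "finite_measure (region_measure D)"
    using triangulated_bodyD(8,9)[OF D] by (rule finite_measure_lebesgue_on[rotated])
  show "ess_bounded (region_measure D) (\<lambda>x. stress D (strain (jacobian u (at x))) \<bullet> ?W x)"
    if "u \<in> vec_fields (P1_space D)" for u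
    by (intro ess_bounded_bilinear[OF bounded_bilinear_inner] ess_bounded_linear[OF S]
        ess_bounded_linear[OF lin] ess_bounded_jacobian D that w)
  fix u v c assume u: "u \<in> vec_fields (P1_space D)"
  show "AE x in region_measure D. stress D (strain (jacobian (\<lambda>y. u y + v y) (at x))) \<bullet> ?W x =
      stress D (strain (jacobian u (at x))) \<bullet> ?W x + stress D (strain (jacobian v (at x))) \<bullet> ?W x"
    if v: "v \<in> vec_fields (P1_space D)"
    using AE_interior_triangle[OF D]
    by eventually_elim
      (simp only: jacobian_at_affine(1)[OF D _ u v] linear_add[OF S] inner_add_left)
  show "AE x in region_measure D. stress D (strain (jacobian (\<lambda>y. c *\<^sub>R u y) (at x))) \<bullet> ?W x =
      c * (stress D (strain (jacobian u (at x))) \<bullet> ?W x)"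
    using AE_interior_triangle[OF D]
    by eventually_elim
      (simp only: jacobian_at_affine(2)[OF D _ u] linear_scale[OF S] inner_scaleR_left)
  show "AE x in region_measure D. stress D (strain (jacobian u (at x))) \<bullet> ?W x =
      stress D (strain (jacobian v (at x))) \<bullet> ?W x"
    if eq: "\<And>x. x \<in> closure (region D) \<Longrightarrow> u x = v x"
  proof -
    have "jacobian u (at x) = jacobian v (at x)" if "x \<in> \<Union>(interior ` tris D)" for x
      using D that u eq by (rule jacobian_at_affine(3))
    then show ?thesis using AE_interior_triangle[OF D] by (auto elim: eventually_mono)
  qed
qed

section \<open>Interface terms and their pullbacks\<close>

lemma ess_bounded_interface_field:
  assumes D: "triangulated_body D" and u: "u \<in> vec_fields (P1_space D)"
  shows "ess_bounded (interface_measure D) u"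
proof (rule ess_bounded_interface[OF piecewise_bounded_continuous[OF compact_interface]])
  show "continuous_on (interface D) u"
    by (rule continuous_on_subset[OF P1_fields_continuous_on[OF D u] interface_subset_closure[OF D]])
qed

lemma P1_functional_interface_pairing:
  assumes D: "triangulated_body D" and w: "ess_bounded (interface_measure D) w"
  shows "P1_functional D (\<lambda>u. pairing (interface_measure D) u w)"
proof (rule P1_functional_pairing[OF finite_measure_arclength D w])
  show "AE x in interface_measure D. u x = v x" if "\<And>x. x \<in> closure (region D) \<Longrightarrow> u x = v x" for u v
    using AE_interface_measure[of D] by eventually_elim (use that interface_subset_closure[OF D] in blast)
qed (auto intro: ess_bounded_interface_field[OF D])

lemma ess_bounded_pullback:
  assumes D: "triangulated_body D" and u: "u \<in> vec_fields (P1_space D)"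
    and \<phi>: "\<phi> \<in> interface B \<rightarrow> interface D" "\<phi> \<in> borel_measurable (interface_measure B)"
  shows "ess_bounded (interface_measure B) (\<lambda>x. u (\<phi> x))"
proof (rule piecewise_bounded_compose[OF complete_arclength _ \<phi>(2)])
  show "piecewise_bounded (interface D) u"
    by (rule piecewise_bounded_continuous[OF compact_interface])
      (rule continuous_on_subset[OF P1_fields_continuous_on[OF D u] interface_subset_closure[OF D]])
  show "AE x in interface_measure B. \<phi> x \<in> interface D"
    using AE_interface_measure[of B] by eventually_elim (use \<phi>(1) in blast)
qed

lemma P1_functional_pullback_pairing:
  assumes D: "triangulated_body D"
    and \<phi>: "\<phi> \<in> interface B \<rightarrow> interface D" "\<phi> \<in> borel_measurable (interface_measure B)"
    and w: "ess_bounded (interface_measure B) w"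
  shows "P1_functional D (\<lambda>u. pairing (interface_measure B) (\<lambda>x. u (\<phi> x)) w)"
proof (rule P1_functional_pairing[OF finite_measure_arclength D w])
  show "AE x in interface_measure B. u (\<phi> x) = v (\<phi> x)"
    if "\<And>x. x \<in> closure (region D) \<Longrightarrow> u x = v x" for u v
    using AE_interface_measure[of B]
    by eventually_elim (use that interface_subset_closure[OF D] \<phi>(1) in blast)
qed (auto intro: ess_bounded_pullback[OF D _ \<phi>])

text \<open>Boundedness comes from compactness of the two interfaces.\<close>

lemma ess_bounded_displacement:
  assumes "\<phi> \<in> interface B \<rightarrow> interface D" "\<phi> \<in> borel_measurable (interface_measure B)"
  shows "ess_bounded (interface_measure B) (\<lambda>x. \<phi> x - x)"
proof -
  have "ess_bounded (interface_measure B) (\<lambda>x. \<phi> x)"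
    by (rule piecewise_bounded_compose[OF complete_arclength _ assms(2), where H = "\<lambda>x. x" and \<Gamma> = "interface D"])
      (use AE_interface_measure[of B] assms(1) in
        \<open>auto intro: piecewise_bounded_continuous compact_interface continuous_on_id\<close>)
  moreover have "ess_bounded (interface_measure B) (\<lambda>x. - x)"
    by (intro ess_bounded_interface piecewise_bounded_continuous compact_interface continuous_intros)
  ultimately have "ess_bounded (interface_measure B) (\<lambda>x. \<phi> x + - x)" by (rule ess_bounded_add)
  then show ?thesis by simp
qed

lemma bounded_bilinear_matrix_vector_mult:
  "bounded_bilinear ((*v) :: real^2^2 \<Rightarrow> real^2 \<Rightarrow> real^2)"
  unfolding bilinear_conv_bounded_bilinear[symmetric]
  by (auto simp: bilinear_def linear_iff matrix_vector_mult_def vec_eq_iff sum_2 algebra_simps)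

text \<open>Along an open edge the adjacent triangle is fixed, and a field affine on it has a single
  gradient there.\<close>

lemma ess_bounded_trace_grad:
  assumes D: "triangulated_body D" and \<tau>: "adjacent_choice D \<tau>" and u: "u \<in> vec_fields (P1_space D)"
  shows "ess_bounded (interface_measure D) (trace_grad \<tau> u)"
proof (rule ess_bounded_interface[OF piecewise_bounded_edges])
  fix a b assume ab: "(a, b) \<in> set (segs (chain D))"
  obtain K where K: "closed_segment a b edge_of K" "K \<in> tris D" "\<forall>x\<in>open_segment a b. \<tau> x = K"
    using adjacent_choice_constant_on_edges[OF D \<tau> ab] by blast
  have inK: "x \<in> K" if "x \<in> open_segment a b" for x
    using that edge_of_imp_subset[OF K(1)] open_closed_segment by blast
  have aff: "affine_fun_on K u" using u K(2) by (simp add: vec_fields_P1_iff[OF D])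
  have "trace_grad \<tau> u x = trace_grad \<tau> u y" if "x \<in> open_segment a b" "y \<in> open_segment a b" for x y
    using jacobian_within_affine(4)[OF triangle_facts(1,2)[OF D K(2)] inK[OF that(1)] aff inK[OF that(2)]] K(3) that
    by (simp add: trace_grad_def)
  then show "\<exists>c. \<forall>x\<in>open_segment a b. trace_grad \<tau> u x = c" by blast
qed

text \<open>Valid at nodes too: whichever triangle \<open>\<tau> x\<close> is, it is the same one
  for all fields involved.\<close>

lemma trace_grad_linear:
  assumes D: "triangulated_body D" and \<tau>: "adjacent_choice D \<tau>" and x: "x \<in> interface D"
    and u: "u \<in> vec_fields (P1_space D)"
  shows "v \<in> vec_fields (P1_space D) \<Longrightarrow>
      trace_grad \<tau> (\<lambda>y. u y + v y) x = trace_grad \<tau> u x + trace_grad \<tau> v x"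
    and "trace_grad \<tau> (\<lambda>y. c *\<^sub>R u y) x = c *\<^sub>R trace_grad \<tau> u x"
    and "(\<And>y. y \<in> closure (region D) \<Longrightarrow> u y = v y) \<Longrightarrow> trace_grad \<tau> u x = trace_grad \<tau> v x"
proof -
  have K: "\<tau> x \<in> tris D" "x \<in> \<tau> x" using \<tau> x by (auto simp: adjacent_choice_def)
  have aff: "affine_fun_on (\<tau> x) f" if "f \<in> vec_fields (P1_space D)" for f
    using that K(1) by (simp add: vec_fields_P1_iff[OF D])
  note J = jacobian_within_affine[OF triangle_facts(1,2)[OF D K(1)] K(2) aff[OF u]]
  show "trace_grad \<tau> (\<lambda>y. u y + v y) x = trace_grad \<tau> u x + trace_grad \<tau> v x"
    if "v \<in> vec_fields (P1_space D)"
    unfolding trace_grad_def by (rule J(1)[OF aff[OF that]])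
  show "trace_grad \<tau> (\<lambda>y. c *\<^sub>R u y) x = c *\<^sub>R trace_grad \<tau> u x" unfolding trace_grad_def by (rule J(2))
  show "trace_grad \<tau> u x = trace_grad \<tau> v x" if "\<And>y. y \<in> closure (region D) \<Longrightarrow> u y = v y"
    unfolding trace_grad_def by (rule J(3)) (use that triangle_facts(4)[OF D K(1)] in blast)
qed

lemma ess_bounded_trace_correction:
  assumes D: "triangulated_body D" and \<tau>: "adjacent_choice D \<tau>" and u: "u \<in> vec_fields (P1_space D)"
    and \<phi>: "\<phi> \<in> interface D \<rightarrow> interface B" "\<phi> \<in> borel_measurable (interface_measure D)"
  shows "ess_bounded (interface_measure D) (\<lambda>x. trace_grad \<tau> u x *v (\<phi> x - x))"
  by (rule ess_bounded_bilinear[OF bounded_bilinear_matrix_vector_mult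
        ess_bounded_trace_grad[OF D \<tau> u] ess_bounded_displacement[OF \<phi>]])

lemma P1_functional_trace_correction:
  assumes D: "triangulated_body D" and \<tau>: "adjacent_choice D \<tau>"
    and \<phi>: "\<phi> \<in> interface D \<rightarrow> interface B" "\<phi> \<in> borel_measurable (interface_measure D)"
    and w: "ess_bounded (interface_measure D) w"
  shows "P1_functional D (\<lambda>u. pairing (interface_measure D) (\<lambda>x. trace_grad \<tau> u x *v (\<phi> x - x)) w)"
proof (rule P1_functional_pairing[OF finite_measure_arclength D w])
  fix u v c assume u: "u \<in> vec_fields (P1_space D)"
  show "ess_bounded (interface_measure D) (\<lambda>x. trace_grad \<tau> u x *v (\<phi> x - x))"
    by (rule ess_bounded_trace_correction[OF D \<tau> u \<phi>])
  show "AE x in interface_measure D. trace_grad \<tau> (\<lambda>x. u x + v x) x *v (\<phi> x - x) =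
      trace_grad \<tau> u x *v (\<phi> x - x) + trace_grad \<tau> v x *v (\<phi> x - x)" if v: "v \<in> vec_fields (P1_space D)"
    using AE_interface_measure[of D]
    by eventually_elim (simp only: trace_grad_linear(1)[OF D \<tau> _ u v] matrix_vector_mult_add_rdistrib)
  show "AE x in interface_measure D. trace_grad \<tau> (\<lambda>x. c *\<^sub>R u x) x *v (\<phi> x - x) =
      c *\<^sub>R (trace_grad \<tau> u x *v (\<phi> x - x))"
    using AE_interface_measure[of D]
    by eventually_elim (simp only: trace_grad_linear(2)[OF D \<tau> _ u] scaleR_matrix_vector_assoc)
  show "AE x in interface_measure D. trace_grad \<tau> u x *v (\<phi> x - x) = trace_grad \<tau> v x *v (\<phi> x - x)"
    if eq: "\<And>x. x \<in> closure (region D) \<Longrightarrow> u x = v x"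
  proof -
    have "trace_grad \<tau> u x = trace_grad \<tau> v x" if "x \<in> interface D" for x
      using D \<tau> that u eq by (rule trace_grad_linear(3))
    then show ?thesis using AE_interface_measure[of D] by (auto elim: eventually_mono)
  qed
qed

lemma interface_subset_interface_tris:
  assumes D: "triangulated_body D" and \<tau>: "adjacent_choice D \<tau>"
  shows "interface D \<subseteq> \<Union>(interface_tris D)"
  using adjacent_choice_interface_tris[OF D \<tau>] \<tau> unfolding adjacent_choice_def by blast

text \<open>The derivative of \<open>J\<close> is taken at \<open>\<phi> x\<close>, which may be a
  node for many \<open>x\<close>. It is therefore first treated as a function on the target
  interface, constant on each open edge, and only then composed with \<open>\<phi>\<close>.\<close>

lemma ess_bounded_extend_mat:
  assumes D: "triangulated_body D" and \<tau>: "adjacent_choice D \<tau>"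
    and J: "\<And>K. K \<in> interface_tris D \<Longrightarrow> affine_fun_on K J"
    and \<phi>: "\<phi> \<in> interface B \<rightarrow> interface D" "\<phi> \<in> borel_measurable (interface_measure B)"
  shows "ess_bounded (interface_measure B) (extend_mat \<tau> \<phi> J)"
  unfolding extend_mat_def[abs_def]
proof (intro ess_bounded_add ess_bounded_vec_lambda)
  have AE: "AE x in interface_measure B. \<phi> x \<in> interface D"
    using AE_interface_measure[of B] by eventually_elim (use \<phi>(1) in blast)
  have "continuous_on (interface D) J"
    using piecewise_affine_continuous_on[OF triangulation_interface_tris[OF D] J]
      interface_subset_interface_tris[OF D \<tau>] by (rule continuous_on_subset)
  then show "ess_bounded (interface_measure B) (\<lambda>x. J (\<phi> x))"
    by (intro piecewise_bounded_compose[OF complete_arclength _ \<phi>(2) AE]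
        piecewise_bounded_continuous compact_interface)
  fix i j :: 2
  let ?H = "\<lambda>y. frechet_derivative J (at y within \<tau> y) (axis j 1)"
  have "piecewise_bounded (interface D) ?H"
  proof (rule piecewise_bounded_edges)
    fix a b assume ab: "(a, b) \<in> set (segs (chain D))"
    obtain K where K: "closed_segment a b edge_of K" "K \<in> tris D" "\<forall>x\<in>open_segment a b. \<tau> x = K"
      using adjacent_choice_constant_on_edges[OF D \<tau> ab] by blast
    have inK: "x \<in> K" if "x \<in> open_segment a b" for x
      using that edge_of_imp_subset[OF K(1)] open_closed_segment by blast
    have "?H x = ?H y" if xy: "x \<in> open_segment a b" "y \<in> open_segment a b" for x y
    proof -
      have "x \<in> interface D" using closed_segment_subset_interface[OF ab] xy(1) open_closed_segment by blast
      then have "affine_fun_on K J" using adjacent_choice_interface_tris[OF D \<tau>] J K(3) xy(1) by metis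
      from frechet_derivative_within_const_affine[OF triangle_facts(1,2)[OF D K(2)] inK[OF xy(1)] inK[OF xy(2)] this]
      show ?thesis using K(3) xy by simp
    qed
    then show "\<exists>c. \<forall>x\<in>open_segment a b. ?H x = c" by blast
  qed
  then have "ess_bounded (interface_measure B) (\<lambda>x. ?H (\<phi> x))"
    by (rule piecewise_bounded_compose[OF complete_arclength _ \<phi>(2) AE])
  moreover have "linear (uminus :: real^2 \<Rightarrow> real^2)" by (simp add: linear_iff)
  from ess_bounded_linear[OF this ess_bounded_displacement[OF \<phi>]]
  have "ess_bounded (interface_measure B) (\<lambda>x. x - \<phi> x)" by simp
  ultimately have "ess_bounded (interface_measure B) (\<lambda>x. ?H (\<phi> x) *v (x - \<phi> x))"
    by (rule ess_bounded_bilinear[OF bounded_bilinear_matrix_vector_mult])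
  then show "ess_bounded (interface_measure B) (\<lambda>x. (?H (\<phi> x) *v (x - \<phi> x)) $ i)"
    by (rule ess_bounded_linear[rotated]) (simp add: linear_iff)
qed

text \<open>The extension at \<open>x\<close> reads \<open>J\<close> only on the single triangle
  \<open>\<tau> (\<phi> x)\<close>, where \<open>J\<close> is affine.\<close>

lemma extend_mat_linear:
  assumes D: "triangulated_body D" and \<tau>: "adjacent_choice D \<tau>" and x: "\<phi> x \<in> interface D"
    and J: "\<And>K. K \<in> interface_tris D \<Longrightarrow> affine_fun_on K J"
  shows "(\<And>K. K \<in> interface_tris D \<Longrightarrow> affine_fun_on K J') \<Longrightarrow>
      extend_mat \<tau> \<phi> (\<lambda>y. J y + J' y) x = extend_mat \<tau> \<phi> J x + extend_mat \<tau> \<phi> J' x"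
    and "extend_mat \<tau> \<phi> (\<lambda>y. c *\<^sub>R J y) x = c *\<^sub>R extend_mat \<tau> \<phi> J x"
proof -
  have K: "\<tau> (\<phi> x) \<in> tris D" "\<phi> x \<in> \<tau> (\<phi> x)" "\<tau> (\<phi> x) \<in> interface_tris D"
    using \<tau> x adjacent_choice_interface_tris[OF D \<tau> x] by (auto simp: adjacent_choice_def)
  note t = triangle_facts(1,2)[OF D K(1)]
  show "extend_mat \<tau> \<phi> (\<lambda>y. J y + J' y) x = extend_mat \<tau> \<phi> J x + extend_mat \<tau> \<phi> J' x"
    if "\<And>K. K \<in> interface_tris D \<Longrightarrow> affine_fun_on K J'"
    unfolding extend_mat_def frechet_derivative_within_add_affine[OF t K(2) J[OF K(3)] that[OF K(3)]]
    by (simp add: vec_eq_iff matrix_vector_mult_add_rdistrib)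
  show "extend_mat \<tau> \<phi> (\<lambda>y. c *\<^sub>R J y) x = c *\<^sub>R extend_mat \<tau> \<phi> J x"
    unfolding extend_mat_def frechet_derivative_within_scaleR_affine[OF t K(2) J[OF K(3)]]
    by (simp add: vec_eq_iff scaleR_matrix_vector_assoc[symmetric] distrib_left)
qed

text \<open>Of the maps leading from \<open>u\<close> to the traction only the recovery is nonlocal,
  and its linearity is an equation between functions. Extension, strain, stress and application to
  the normal are then linear at each \<open>x\<close> with \<open>\<phi> x\<close> on the interface,
  that is, at almost every \<open>x\<close>.\<close>

lemma P1_functional_extended_stress:
  assumes D: "triangulated_body D" and adm: "admissible_patches D" and \<tau>: "adjacent_choice D \<tau>"
    and B: "triangulated_body B"
    and \<phi>: "\<phi> \<in> interface B \<rightarrow> interface D" "\<phi> \<in> borel_measurable (interface_measure B)"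
    and w: "ess_bounded (interface_measure B) w"
  shows "P1_functional D (\<lambda>u. pairing (interface_measure B)
     (\<lambda>x. extended_stress D \<tau> \<phi> u x *v outward_normal (region B) x) w)"
proof (rule P1_functional_pairing[OF finite_measure_arclength D w])
  note S = linear_stress_strain[of D]
  note aff = recovered_jacobian_affine[OF D adm]
  let ?n = "outward_normal (region B)"
  have AE: "AE x in interface_measure B. \<phi> x \<in> interface D"
    using AE_interface_measure[of B] by eventually_elim (use \<phi>(1) in blast)
  have n: "ess_bounded (interface_measure B) ?n"
    by (intro ess_bounded_interface piecewise_bounded_edges outward_normal_constant_on_edges[OF B])
  fix u v c assume u: "u \<in> vec_fields (P1_space D)"
  show "ess_bounded (interface_measure B) (\<lambda>x. extended_stress D \<tau> \<phi> u x *v ?n x)"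
    unfolding extended_stress_def
    by (intro ess_bounded_bilinear[OF bounded_bilinear_matrix_vector_mult _ n] ess_bounded_linear[OF S]
        ess_bounded_extend_mat[OF D \<tau> aff \<phi>])
  show "AE x in interface_measure B. extended_stress D \<tau> \<phi> (\<lambda>x. u x + v x) x *v ?n x =
      extended_stress D \<tau> \<phi> u x *v ?n x + extended_stress D \<tau> \<phi> v x *v ?n x"
    if v: "v \<in> vec_fields (P1_space D)"
    using AE
    by eventually_elim
      (simp only: extended_stress_def recovered_jacobian_add[OF D adm u v]
        extend_mat_linear(1)[OF D \<tau> _ aff aff] linear_add[OF S] matrix_vector_mult_add_rdistrib)
  show "AE x in interface_measure B. extended_stress D \<tau> \<phi> (\<lambda>x. c *\<^sub>R u x) x *v ?n x =
      c *\<^sub>R (extended_stress D \<tau> \<phi> u x *v ?n x)"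
    using AE
    by eventually_elim
      (simp only: extended_stress_def recovered_jacobian_scaleR[OF D adm u]
        extend_mat_linear(2)[OF D \<tau> _ aff] linear_scale[OF S] scaleR_matrix_vector_assoc)
  show "AE x in interface_measure B. extended_stress D \<tau> \<phi> u x *v ?n x = extended_stress D \<tau> \<phi> v x *v ?n x"
    if "\<And>x. x \<in> closure (region D) \<Longrightarrow> u x = v x"
  proof -
    have "recovered_jacobian D u = recovered_jacobian D v" by (rule recovered_jacobian_cong[OF D adm]) fact
    then show ?thesis by (simp add: extended_stress_def)
  qed
qed

section \<open>Square-integrable interface data\<close>

lemma L2_pairing_integrable:
  assumes M: "finite_measure M" and f: "f \<in> L2 M" and w: "ess_bounded M w"
  shows "integrable M (\<lambda>x. f x \<bullet> w x)"
proof -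
  obtain B where B: "AE x in M. norm (w x) \<le> B" using w unfolding ess_bounded_def by blast
  \<comment> \<open>\<open>f\<close> is only square integrable, hence the majorant with
    \<open>1 + |f|^2\<close>, integrable because the measure is finite; the absolute value keeps it
    nonnegative.\<close>
  have "integrable M (\<lambda>x. \<bar>B\<bar> * (1 + (norm (f x))\<^sup>2))"
    using f by (intro integrable_mult_right Bochner_Integration.integrable_add finite_measure.integrable_const[OF M])
      (simp add: L2_def)
  then show ?thesis
  proof (rule Bochner_Integration.integrable_bound)
    show "(\<lambda>x. f x \<bullet> w x) \<in> borel_measurable M"
      using f w by (auto simp: L2_def ess_bounded_def)
    show "AE x in M. norm (f x \<bullet> w x) \<le> norm (\<bar>B\<bar> * (1 + (norm (f x))\<^sup>2))"
      using B
    proof eventually_elim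
      case (elim x)
      have "\<bar>f x \<bullet> w x\<bar> \<le> norm (f x) * norm (w x)" by (rule Cauchy_Schwarz_ineq2)
      also have "\<dots> \<le> (1 + (norm (f x))\<^sup>2) * \<bar>B\<bar>"
      proof (rule mult_mono)
        \<comment> \<open>Gives \<open>2 n \<le> 1 + n^2\<close> for the norm \<open>n\<close>, and
          \<open>n \<le> 2 n\<close>.\<close>
        have "0 \<le> (norm (f x) - 1)\<^sup>2" by simp
        then show "norm (f x) \<le> 1 + (norm (f x))\<^sup>2"
          unfolding power2_diff using norm_ge_zero[of "f x"] by (simp del: norm_ge_zero)
      qed (use elim in auto)
      finally show ?case by (simp add: mult.commute)
    qed
  qed
qed

lemma L2_diff:
  assumes "f \<in> L2 M" "g \<in> L2 M" shows "(\<lambda>x. f x - g x) \<in> L2 M"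
proof -
  have "integrable M (\<lambda>x. 2 * (norm (f x))\<^sup>2 + 2 * (norm (g x))\<^sup>2)" using assms by (auto simp: L2_def)
  then have "integrable M (\<lambda>x. (norm (f x - g x))\<^sup>2)"
  proof (rule Bochner_Integration.integrable_bound)
    show "(\<lambda>x. (norm (f x - g x))\<^sup>2) \<in> borel_measurable M" using assms by (auto simp: L2_def)
    show "AE x in M. norm ((norm (f x - g x))\<^sup>2) \<le> norm (2 * (norm (f x))\<^sup>2 + 2 * (norm (g x))\<^sup>2)"
    proof (rule AE_I2)
      fix x
      have "(norm (f x - g x))\<^sup>2 \<le> (norm (f x) + norm (g x))\<^sup>2"
        by (intro power_mono norm_triangle_ineq4) auto
      also have "\<dots> \<le> 2 * (norm (f x))\<^sup>2 + 2 * (norm (g x))\<^sup>2" 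
        using zero_le_power2[of "norm (f x) - norm (g x)"] by (simp add: power2_sum power2_diff)
      finally show "norm ((norm (f x - g x))\<^sup>2) \<le> norm (2 * (norm (f x))\<^sup>2 + 2 * (norm (g x))\<^sup>2)" by simp
    qed
  qed
  then show ?thesis using assms by (auto simp: L2_def)
qed

text \<open>Cauchy-Schwarz bounds the change of the pairing by \<open>L2_dist\<close> times the norm
  \<open>sqrt W\<close> of \<open>w\<close>. It is derived from nonnegativity in \<open>t\<close> of
  the integral of \<open>|d + t w|^2\<close>, where \<open>d\<close> is the difference of
  \<open>g k\<close> and \<open>gl\<close>.\<close>

lemma L2_pairing_tendsto:
  assumes M: "finite_measure M" and g: "\<And>k. g k \<in> L2 M" and gl: "gl \<in> L2 M"
    and lim: "(\<lambda>k. L2_dist M (g k) gl) \<longlonglongrightarrow> 0" and w: "ess_bounded M w"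
  shows "(\<lambda>k. pairing M (g k) w) \<longlonglongrightarrow> pairing M gl w"
proof -
  define W where "W = (LINT x|M. (norm (w x))\<^sup>2)"
  have wL2: "integrable M (\<lambda>x. (norm (w x))\<^sup>2)"
    using ess_bounded_integrable[OF M ess_bounded_bilinear[OF bounded_bilinear_inner w w]]
    by (simp add: dot_square_norm)
  have "\<bar>pairing M (g k) w - pairing M gl w\<bar> \<le> L2_dist M (g k) gl * sqrt W" for k
  proof -
    let ?d = "\<lambda>x. g k x - gl x"
    define E where "E = (LINT x|M. (norm (?d x))\<^sup>2)"
    define P where "P = (LINT x|M. ?d x \<bullet> w x)"
    have d: "?d \<in> L2 M" by (rule L2_diff[OF g gl])
    then have dint: "integrable M (\<lambda>x. (norm (?d x))\<^sup>2)" by (simp add: L2_def)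
    note dw = L2_pairing_integrable[OF M d w]
    have sq: "(norm (a + t *\<^sub>R b))\<^sup>2 = (norm a)\<^sup>2 + 2 * t * (a \<bullet> b) + t\<^sup>2 * (norm b)\<^sup>2"
      for a b :: "real^2" and t
      unfolding power2_norm_eq_inner
      by (simp add: inner_add_left inner_add_right inner_commute power2_eq_square)
    have pos: "0 \<le> E + 2 * t * P + t\<^sup>2 * W" for t
    proof -
      have "0 \<le> (LINT x|M. (norm (?d x + t *\<^sub>R w x))\<^sup>2)" by (rule Bochner_Integration.integral_nonneg) simp
      also have "\<dots> = (LINT x|M. (norm (?d x))\<^sup>2 + 2 * t * (?d x \<bullet> w x) + t\<^sup>2 * (norm (w x))\<^sup>2)"
        by (simp only: sq)
      also have "\<dots> = E + 2 * t * P + t\<^sup>2 * W"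
        using dint dw wL2 by (simp add: E_def P_def W_def)
      finally show ?thesis .
    qed
    have "P\<^sup>2 \<le> E * W"
    proof (cases "W = 0")
      case True
      have "P = 0"
      proof (rule ccontr)
        assume "P \<noteq> 0"
        \<comment> \<open>With \<open>W = 0\<close> the expression is affine in \<open>t\<close>;
          this choice of \<open>t\<close> gives it the value \<open>- 1\<close>.\<close>
        then show False using pos[of "- (E + 1) / (2 * P)"] True by (simp add: field_simps)
      qed
      then show ?thesis using True by simp
    next
      case False
      have "W \<ge> 0" unfolding W_def by (rule Bochner_Integration.integral_nonneg) simp
      then have "W > 0" using False by simp
      \<comment> \<open>The minimiser of the quadratic, where its value is
        \<open>E - P^2 / W\<close>.\<close>
      then show ?thesis using pos[of "- P / W"] by (simp add: field_simps power2_eq_square)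
    qed
    then have "\<bar>P\<bar> \<le> sqrt (E * W)" by (metis real_sqrt_abs real_sqrt_le_iff)
    moreover have "pairing M (g k) w - pairing M gl w = P"
      unfolding pairing_def P_def inner_diff_left
      using L2_pairing_integrable[OF M g w] L2_pairing_integrable[OF M gl w] by simp
    ultimately show ?thesis by (simp add: L2_dist_def E_def real_sqrt_mult)
  qed
  then have "(\<lambda>k. pairing M (g k) w - pairing M gl w) \<longlonglongrightarrow> 0"
    by (intro Lim_null_comparison[OF _ tendsto_mult_left_zero[OF lim, of "sqrt W"]]) auto
  then show ?thesis by (rule LIM_zero_cancel)
qed

section \<open>Passage to the limit\<close>

lemma ess_bounded_W:
  assumes "w \<in> vec_fields (W_space D)" shows "ess_bounded (interface_measure D) w"
proof -
  have "continuous_on (interface D) (\<lambda>x. \<chi> i. w x $ i)"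
    using assms by (intro continuous_on_vec_lambda) (simp add: vec_fields_def W_space_def)
  then show ?thesis
    by (intro ess_bounded_interface piecewise_bounded_continuous compact_interface) simp
qed

text \<open>Uniform convergence on the closed domains renders convergence in the finite-dimensional
  spaces. The limits are given merely as functions, so their membership in \<open>V_space\<close> is
  part of what is shown.\<close>

theorem mainTheorem2:
  fixes S M :: body
    and \<phi>sm \<phi>ms :: "real^2 \<Rightarrow> real^2"
    and \<tau> :: "real^2 \<Rightarrow> (real^2) set"
    and fs fm :: "real^2 \<Rightarrow> real^2"
    and C \<omega> :: real
    and us um g :: "nat \<Rightarrow> real^2 \<Rightarrow> real^2"
    and us_lim um_lim g_lim :: "real^2 \<Rightarrow> real^2"
  assumes "triangulated_body S" and "triangulated_body M"
    and "\<phi>sm \<in> interface S \<rightarrow> interface M" and "\<phi>ms \<in> interface M \<rightarrow> interface S"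
    and "\<phi>sm \<in> borel_measurable (interface_measure S)"
    and "\<phi>ms \<in> borel_measurable (interface_measure M)"
    and "\<forall>x\<in>interface S. dist x (\<phi>sm x) \<le> C * max (mesh_size S) (mesh_size M)"
    and "\<forall>x\<in>interface M. dist x (\<phi>ms x) \<le> C * max (mesh_size S) (mesh_size M)"
    and "adjacent_choice S \<tau>"
    and "admissible_patches S"
    and "fs \<in> L2 (region_measure S)" and "fm \<in> L2 (region_measure M)"
    and "0 < \<omega>" and "\<omega> \<le> 1"
    and "\<forall>k. us k \<in> vec_fields (V_space S)" and "\<forall>k. um k \<in> vec_fields (V_space M)"
    and "\<forall>k. g k \<in> L2 (interface_measure S)"
    and "\<forall>k. \<forall>v\<in>vec_fields (V0_space S).
           elastic_form S (us k) v = pairing (region_measure S) fs v"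
    and "\<forall>k. \<forall>w\<in>vec_fields (W_space S).
           pairing (interface_measure S) (us k) w = pairing (interface_measure S) (g k) w"
    and "\<forall>k. \<forall>v\<in>vec_fields (V_space M).
           elastic_form M (um k) v
             - pairing (interface_measure M)
                 (\<lambda>x. extended_stress S \<tau> \<phi>ms (us k) x *v outward_normal (region M) x) v
           = pairing (region_measure M) fm v"
    and "\<forall>k. AE x in interface_measure S.
           g (Suc k) x = \<omega> *\<^sub>R (um k (\<phi>sm x) - trace_grad \<tau> (us k) x *v (\<phi>sm x - x))
                         + (1 - \<omega>) *\<^sub>R g k x"
    and "g_lim \<in> L2 (interface_measure S)"
    and "(\<lambda>k. L2_dist (interface_measure S) (g k) g_lim) \<longlonglongrightarrow> 0"
    and "uniform_limit (closure (region S)) us us_lim sequentially"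
    and "uniform_limit (closure (region M)) um um_lim sequentially"
  shows "us_lim \<in> vec_fields (V_space S) \<and> um_lim \<in> vec_fields (V_space M) \<and>
    (\<forall>v\<in>vec_fields (V0_space S).
       elastic_form S us_lim v = pairing (region_measure S) fs v) \<and>
    (\<forall>w\<in>vec_fields (W_space S).
       pairing (interface_measure S) (\<lambda>x. extend_vec \<tau> \<phi>sm us_lim x - um_lim (\<phi>sm x)) w = 0) \<and>
    (\<forall>v\<in>vec_fields (V_space M).
       elastic_form M um_lim v
         - pairing (interface_measure M)
             (\<lambda>x. extended_stress S \<tau> \<phi>ms us_lim x *v outward_normal (region M) x) v
       = pairing (region_measure M) fm v)"
proof -
  note D = assms(1,2) and adm = assms(10) and \<tau> = assms(9)
  let ?\<Gamma> = "interface_measure S"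
  have us: "us k \<in> vec_fields (P1_space S)" and um: "um k \<in> vec_fields (P1_space M)" for k
    using assms(15,16) by (auto simp: vec_fields_def V_space_def)
  have sub: "V0_space S \<subseteq> P1_space S" "V_space M \<subseteq> P1_space M" by (auto simp: V0_space_def V_space_def)
  have us_lim: "(\<lambda>k. us k x) \<longlonglongrightarrow> us_lim x" if "x \<in> closure (region S)" for x
    using assms(24) that by (rule tendsto_uniform_limitI)
  have um_lim: "(\<lambda>k. um k x) \<longlonglongrightarrow> um_lim x" if "x \<in> closure (region M)" for x
    using assms(25) that by (rule tendsto_uniform_limitI)
  note limS = P1_functional_tendsto[OF D(1) _ us us_lim] and limM = P1_functional_tendsto[OF D(2) _ um um_lim]
  have V: "us_lim \<in> vec_fields (V_space S)" "um_lim \<in> vec_fields (V_space M)"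
    using V_limit[OF D(1) assms(15)[rule_format] us_lim] V_limit[OF D(2) assms(16)[rule_format] um_lim] by auto
  have P1: "us_lim \<in> vec_fields (P1_space S)" "um_lim \<in> vec_fields (P1_space M)"
    using P1_limit[OF D(1) us us_lim] P1_limit[OF D(2) um um_lim] by auto
  have eq1: "elastic_form S us_lim v = pairing (region_measure S) fs v" if v: "v \<in> vec_fields (V0_space S)" for v
  proof -
    have "v \<in> vec_fields (P1_space S)" using v sub(1) by (auto simp: vec_fields_def)
    \<comment> \<open>Along the iterates this functional is constant by the first equation, so its
      limit is that constant.\<close>
    from limS[OF P1_functional_elastic_form[OF D(1) this]] show ?thesis
      using assms(18) v by (simp add: LIMSEQ_const_iff)
  qed
  have eq3: "elastic_form M um_lim v - pairing (interface_measure M)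
        (\<lambda>x. extended_stress S \<tau> \<phi>ms us_lim x *v outward_normal (region M) x) v
      = pairing (region_measure M) fm v" if v: "v \<in> vec_fields (V_space M)" for v
  proof -
    have v': "v \<in> vec_fields (P1_space M)" using v sub(2) by (auto simp: vec_fields_def)
    have "(\<lambda>k. elastic_form M (um k) v - pairing (interface_measure M)
        (\<lambda>x. extended_stress S \<tau> \<phi>ms (us k) x *v outward_normal (region M) x) v) \<longlonglongrightarrow>
      elastic_form M um_lim v - pairing (interface_measure M)
        (\<lambda>x. extended_stress S \<tau> \<phi>ms us_lim x *v outward_normal (region M) x) v"
      by (intro tendsto_diff limM[OF P1_functional_elastic_form[OF D(2) v']]
          limS[OF P1_functional_extended_stress[OF D(1) adm \<tau> D(2) assms(4,6)
              ess_bounded_interface_field[OF D(2) v']]])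
    then show ?thesis using assms(20) v by (simp add: LIMSEQ_const_iff)
  qed
  have eq2: "pairing ?\<Gamma> (\<lambda>x. extend_vec \<tau> \<phi>sm us_lim x - um_lim (\<phi>sm x)) w = 0"
    if w: "w \<in> vec_fields (W_space S)" for w
  proof -
    note wb = ess_bounded_W[OF w] and fin = finite_measure_arclength[of "chain S"]
    let ?T = "\<lambda>u x. trace_grad \<tau> u x *v (\<phi>sm x - x)"
    have glim: "(\<lambda>k. pairing ?\<Gamma> (g k) w) \<longlonglongrightarrow> pairing ?\<Gamma> g_lim w"
      by (rule L2_pairing_tendsto[OF fin assms(17)[rule_format] assms(22,23) wb])
    have "(\<lambda>k. pairing ?\<Gamma> (us k) w) \<longlonglongrightarrow> pairing ?\<Gamma> us_lim w"
      by (rule limS[OF P1_functional_interface_pairing[OF D(1) wb]])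
    \<comment> \<open>The second equation in the limit: \<open>us_lim\<close> and
      \<open>g_lim\<close> agree when tested with \<open>w\<close>, while \<open>g_lim\<close>
      itself need not be a finite element function.\<close>
    then have us_g: "pairing ?\<Gamma> us_lim w = pairing ?\<Gamma> g_lim w"
      using glim assms(19) w by (simp add: LIMSEQ_unique)
    have int: "integrable ?\<Gamma> (\<lambda>x. h x \<bullet> w x)" if "ess_bounded ?\<Gamma> h" for h
      by (rule ess_bounded_integrable[OF fin ess_bounded_bilinear[OF bounded_bilinear_inner that wb]])
    note bu = ess_bounded_pullback[OF D(2) _ assms(3,5)]
      and bt = ess_bounded_trace_correction[OF D(1) \<tau> _ assms(3,5)]
    \<comment> \<open>The update holds almost everywhere, so it may be integrated against
      \<open>w\<close>; the terms in \<open>g k\<close> are integrable by square integrability, the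
      others by essential boundedness.\<close>
    have step: "pairing ?\<Gamma> (g (Suc k)) w = \<omega> * (pairing ?\<Gamma> (\<lambda>x. um k (\<phi>sm x)) w - pairing ?\<Gamma> (?T (us k)) w)
        + (1 - \<omega>) * pairing ?\<Gamma> (g k) w" for k
    proof -
      note i = int[OF bu[OF um[of k]]] int[OF bt[OF us[of k]]]
        and gi = L2_pairing_integrable[OF fin assms(17)[rule_format] wb]
      have "pairing ?\<Gamma> (g (Suc k)) w =
        (LINT x|?\<Gamma>. \<omega> * (um k (\<phi>sm x) \<bullet> w x - ?T (us k) x \<bullet> w x) + (1 - \<omega>) * (g k x \<bullet> w x))"
        unfolding pairing_def
      proof (rule integral_cong_AE)
        show "AE x in ?\<Gamma>. g (Suc k) x \<bullet> w x =
            \<omega> * (um k (\<phi>sm x) \<bullet> w x - ?T (us k) x \<bullet> w x) + (1 - \<omega>) * (g k x \<bullet> w x)"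
          using assms(21)[rule_format, of k]
          by eventually_elim (simp add: inner_add_left inner_diff_left)
      qed (use i gi in \<open>auto intro!: borel_measurable_integrable\<close>)
      then show ?thesis using i gi[of k] by (simp add: pairing_def)
    qed
    have "(\<lambda>k. \<omega> * (pairing ?\<Gamma> (\<lambda>x. um k (\<phi>sm x)) w - pairing ?\<Gamma> (?T (us k)) w)
        + (1 - \<omega>) * pairing ?\<Gamma> (g k) w) \<longlonglongrightarrow>
      \<omega> * (pairing ?\<Gamma> (\<lambda>x. um_lim (\<phi>sm x)) w - pairing ?\<Gamma> (?T us_lim) w) + (1 - \<omega>) * pairing ?\<Gamma> g_lim w"
      by (intro tendsto_intros glim limM[OF P1_functional_pullback_pairing[OF D(2) assms(3,5) wb]]
          limS[OF P1_functional_trace_correction[OF D(1) \<tau> assms(3,5) wb]])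
    then have "(\<lambda>k. pairing ?\<Gamma> (g (Suc k)) w) \<longlonglongrightarrow>
      \<omega> * (pairing ?\<Gamma> (\<lambda>x. um_lim (\<phi>sm x)) w - pairing ?\<Gamma> (?T us_lim) w) + (1 - \<omega>) * pairing ?\<Gamma> g_lim w"
      by (simp add: step)
    \<comment> \<open>The shifted sequence has the same limit, so tested with \<open>w\<close> the
      function \<open>g_lim\<close> is a fixed point of the update, and the term with
      \<open>1 - \<omega>\<close> cancels.\<close>
    from LIMSEQ_unique[OF LIMSEQ_Suc[OF glim] this]
    have "\<omega> * pairing ?\<Gamma> g_lim w = \<omega> * (pairing ?\<Gamma> (\<lambda>x. um_lim (\<phi>sm x)) w - pairing ?\<Gamma> (?T us_lim) w)"
      by (simp add: algebra_simps)
    \<comment> \<open>Here \<open>\<omega> > 0\<close> permits division, and \<open>us_g\<close>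
      replaces \<open>g_lim\<close> by \<open>us_lim\<close>.\<close>
    then have fix_pt: "pairing ?\<Gamma> us_lim w = pairing ?\<Gamma> (\<lambda>x. um_lim (\<phi>sm x)) w - pairing ?\<Gamma> (?T us_lim) w"
      using us_g assms(13) by simp
    \<comment> \<open>\<open>extend_vec\<close> is the trace plus the correction \<open>?T\<close>;
      moving that correction to the left-hand side of \<open>fix_pt\<close> yields the coupling
      condition.\<close>
    have "pairing ?\<Gamma> (\<lambda>x. extend_vec \<tau> \<phi>sm us_lim x - um_lim (\<phi>sm x)) w =
        pairing ?\<Gamma> us_lim w + pairing ?\<Gamma> (?T us_lim) w - pairing ?\<Gamma> (\<lambda>x. um_lim (\<phi>sm x)) w"
      using int[OF ess_bounded_interface_field[OF D(1) P1(1)]] int[OF bt[OF P1(1)]] int[OF bu[OF P1(2)]]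
      by (simp add: pairing_def extend_vec_def inner_add_left inner_diff_left)
    then show ?thesis using fix_pt by simp
  qed
  show ?thesis using V eq1 eq2 eq3 by blast
qed

end
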